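(* For every domain size $k$, every $\alpha\in(0,1]$, every $\varepsilon_1,\varepsilon_2\in(0,1]$ with $\varepsilon_1\ge\varepsilon_2$, and every $\delta\in(0,1]$, there exists a private-coin protocol for closeness testing between two unknown distributions $\mathbf p,\mathbf q$ over $[k]$ with distance parameter $\alpha$ using $$n_1=O\!\left(\frac{\sqrt k}{\alpha^2}+\frac{k^{3/4}\sqrt{\log(1/\delta)}}{\alpha\varepsilon_1}+\min\!\left(\frac{\varepsilon_1^2\varepsilon_2^2}{\alpha^4\log^2(1/\delta)},\ \frac{k^{2/3}}{\alpha^{4/3}}\Big(\frac{\varepsilon_2}{\varepsilon_1}\Big)^{2/3}\right)\right)$$ users holding samples from $\mathbf p$ and $n_2=\left(\frac{\varepsilon_1}{\varepsilon_2}\right)^2 n_1$ users holding samples from $\mathbf q$, which is $(\varepsilon_1,\delta)$-shuffle differentially private for the samples from $\mathbf p$ and $(\varepsilon_2,\delta)$-shuffle differentially private for the samples from $\mathbf q$.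
   Context: Closeness testing: given $\alpha\in(0,1]$ and independent samples from unknown distributions $\mathbf p,\mathbf q$ over $[k]$, output accept with probability at least $2/3$ if $\mathbf p=\mathbf q$, and reject with probability at least $2/3$ if $d_{TV}(\mathbf p,\mathbf q)=\frac12\|\mathbf p-\mathbf q\|_1>\alpha$. Heterogeneous shuffle model: $n_1$ users each hold one independent sample from $\mathbf p$, and $n_2$ users each hold one independent sample from $\mathbf q$. Each user of the first group applies a randomizer $R_i$ to their sample (and possibly a public random string $U$ of length $r$) producing a (possibly multi-message) output; a shuffler $S_1$ concatenates all messages of the first group and applies a uniformly random permutation to them. Likewise each user of the second group applies $R'_i$, and a separate shuffler $S_2$ concatenates and uniformly permutes the messages of the second group. The analyzer receives the outputs of $S_1$ and $S_2$ (and $U$) and outputs accept/reject satisfying the closeness testing guarantee. The protocol is private-coin if $r=0$, public-coin otherwise. It is $(\varepsilon_1,\delta)$-shuffle differentially private for the first group if the output of $S_1$, as a randomized function of the dataset $(x_1,\dots,x_{n_1})$, is $(\varepsilon_1,\delta)$-differentially private, i.e. for all datasets differing in one entry and all measurable $S$, $\Pr[\text{output}\in S]\le e^{\varepsilon_1}\Pr[\text{output}'\in S]+\delta$; similarly for the second group with $S_2$ and $\varepsilon_2$.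
   Formalization: For 1/e < δ ≤ 1 the minimum is replaced by its second argument: as stated the bound is false for δ near 1 (constant α, ε1=ε2=1, log(1/δ)=k^(-1/4) gives k^(5/8), below the k^(2/3) needed even without privacy). n2 is rounded up to an integer. *)

theory Defs
  imports "HOL-Probability.Probability" "HOL-Combinatorics.Permutations"
begin

text \<open>
  The domain \<open>[k]\<close> is \<open>{1..k}\<close>. A distribution over \<open>[k]\<close> is a pmf on the naturals
  supported in \<open>{1..k}\<close>; a dataset of \<open>n\<close> samples is a function used on \<open>{..<n}\<close> only.
\<close>

definition distributions_on :: "nat \<Rightarrow> nat pmf set" where
  "distributions_on k = {p. set_pmf p \<subseteq> {1..k}}"

definition tv_distance :: "nat \<Rightarrow> nat pmf \<Rightarrow> nat pmf \<Rightarrow> real" where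
  "tv_distance k p q = (\<Sum>x\<in>{1..k}. \<bar>pmf p x - pmf q x\<bar>) / 2"

text \<open>
  A randomizer maps the public string and the user's sample to a random finite list of
  messages, of any length. User \<open>i\<close> of a group uses the \<open>i\<close>-th randomizer of that group.
  The analyzer sees the public string and the two shuffled lists, may use its own randomness,
  and returns \<open>True\<close> for accept.
\<close>

type_synonym 'm randomizer = "bool list \<Rightarrow> nat \<Rightarrow> 'm list pmf"

record 'm shuffle_protocol =
  public_bits :: nat
  users1 :: nat
  users2 :: nat
  randomizers1 :: "nat \<Rightarrow> 'm randomizer"
  randomizers2 :: "nat \<Rightarrow> 'm randomizer"
  analyzer :: "bool list \<Rightarrow> 'm list \<Rightarrow> 'm list \<Rightarrow> bool pmf"

definition private_coin :: "'m shuffle_protocol \<Rightarrow> bool" where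
  "private_coin P \<longleftrightarrow> public_bits P = 0"

definition public_strings :: "'m shuffle_protocol \<Rightarrow> bool list set" where
  "public_strings P = {U. length U = public_bits P}"

definition shuffle_messages :: "'m list \<Rightarrow> 'm list pmf" where
  "shuffle_messages ms =
     map_pmf (\<lambda>\<pi>. permute_list \<pi> ms) (pmf_of_set {\<pi>. \<pi> permutes {..<length ms}})"

definition shuffler_output ::
    "nat \<Rightarrow> (nat \<Rightarrow> 'm randomizer) \<Rightarrow> bool list \<Rightarrow> (nat \<Rightarrow> nat) \<Rightarrow> 'm list pmf" where
  "shuffler_output n R U xs =
     bind_pmf (Pi_pmf {..<n} [] (\<lambda>i. R i U (xs i)))
       (\<lambda>Y. shuffle_messages (concat (map Y [0..<n])))"

definition iid_samples :: "nat \<Rightarrow> nat pmf \<Rightarrow> (nat \<Rightarrow> nat) pmf" where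
  "iid_samples n p = Pi_pmf {..<n} 0 (\<lambda>_. p)"

definition run_protocol :: "'m shuffle_protocol \<Rightarrow> nat pmf \<Rightarrow> nat pmf \<Rightarrow> bool pmf" where
  "run_protocol P p q =
     bind_pmf (pmf_of_set (public_strings P)) (\<lambda>U.
     bind_pmf (iid_samples (users1 P) p) (\<lambda>xs.
     bind_pmf (iid_samples (users2 P) q) (\<lambda>ys.
     bind_pmf (shuffler_output (users1 P) (randomizers1 P) U xs) (\<lambda>ms1.
     bind_pmf (shuffler_output (users2 P) (randomizers2 P) U ys) (\<lambda>ms2.
     analyzer P U ms1 ms2)))))"

definition tests_closeness :: "nat \<Rightarrow> real \<Rightarrow> 'm shuffle_protocol \<Rightarrow> bool" where
  "tests_closeness k \<alpha> P \<longleftrightarrow>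
     (\<forall>p \<in> distributions_on k. \<forall>q \<in> distributions_on k.
        (p = q \<longrightarrow> pmf (run_protocol P p q) True \<ge> 2/3) \<and>
        (tv_distance k p q > \<alpha> \<longrightarrow> pmf (run_protocol P p q) False \<ge> 2/3))"

definition neighbouring :: "nat \<Rightarrow> (nat \<Rightarrow> nat) \<Rightarrow> (nat \<Rightarrow> nat) \<Rightarrow> bool" where
  "neighbouring n xs xs' \<longleftrightarrow> (\<exists>j<n. \<forall>i<n. i \<noteq> j \<longrightarrow> xs i = xs' i)"

definition differentially_private ::
    "nat \<Rightarrow> nat \<Rightarrow> real \<Rightarrow> real \<Rightarrow> ((nat \<Rightarrow> nat) \<Rightarrow> 'o pmf) \<Rightarrow> bool" where
  "differentially_private k n \<epsilon> \<delta> M \<longleftrightarrow>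
     (\<forall>xs xs'. (\<forall>i<n. xs i \<in> {1..k}) \<longrightarrow> (\<forall>i<n. xs' i \<in> {1..k}) \<longrightarrow> neighbouring n xs xs' \<longrightarrow>
        (\<forall>S. measure_pmf.prob (M xs) S \<le> exp \<epsilon> * measure_pmf.prob (M xs') S + \<delta>))"

text \<open>Since the public string is known to everybody, privacy is required for each of its values.\<close>

definition shuffle_private1 :: "nat \<Rightarrow> real \<Rightarrow> real \<Rightarrow> 'm shuffle_protocol \<Rightarrow> bool" where
  "shuffle_private1 k \<epsilon> \<delta> P \<longleftrightarrow>
     (\<forall>U \<in> public_strings P.
        differentially_private k (users1 P) \<epsilon> \<delta> (shuffler_output (users1 P) (randomizers1 P) U))"

definition shuffle_private2 :: "nat \<Rightarrow> real \<Rightarrow> real \<Rightarrow> 'm shuffle_protocol \<Rightarrow> bool" where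
  "shuffle_private2 k \<epsilon> \<delta> P \<longleftrightarrow>
     (\<forall>U \<in> public_strings P.
        differentially_private k (users2 P) \<epsilon> \<delta> (shuffler_output (users2 P) (randomizers2 P) U))"

text \<open>
  The first argument of the minimum below is meant for \<open>\<delta>\<close> bounded away from 1, as is
  customary for bounds in \<open>log (1/\<delta>)\<close>, and is used only when \<open>ln (1/\<delta>) \<ge> 1\<close>. For \<open>\<delta> = 1\<close> it
  divides by zero and stands for infinity, so that the minimum is its second argument.
  For \<open>\<delta> < 1\<close> close to 1, keeping it would give a false bound: with \<open>\<alpha>\<close> a small constant,
  \<open>\<epsilon>1 = \<epsilon>2 = 1\<close> and \<open>ln (1/\<delta>) = k powr (-1/4)\<close>, the three terms would be of order
  \<open>k powr (1/2)\<close>, \<open>k powr (5/8)\<close> and \<open>k powr (1/2)\<close>, whereas closeness testing needs order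
  \<open>k powr (2/3)\<close> samples even without privacy.
\<close>

definition min_term :: "nat \<Rightarrow> real \<Rightarrow> real \<Rightarrow> real \<Rightarrow> real \<Rightarrow> real" where
  "min_term k \<alpha> \<epsilon>1 \<epsilon>2 \<delta> =
     (let a = (\<epsilon>1^2 * \<epsilon>2^2) / (\<alpha>^4 * (ln (1/\<delta>))^2);
          b = (real k powr (2/3) / \<alpha> powr (4/3)) * (\<epsilon>2/\<epsilon>1) powr (2/3)
      in if ln (1/\<delta>) \<ge> 1 then min a b else b)"

end

theory Submission
  imports Defs
begin

text \<open>
  Every data user sends its sample with probability 1/3 and otherwise stays silent; this alone is
  \<open>(0, 1/3)\<close>-private and settles \<open>ln (1/\<delta>) < 1\<close>. For smaller \<open>\<delta>\<close> one extra user, whose own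
  sample is ignored, adds to each histogram cell a truncated two-sided geometric number of fake
  messages, of variance \<open>O(1/\<epsilon>\<^sup>2)\<close>.

  The users of a group are divided into three classes, which yields three independent noisy
  histograms per group. The first two give independent unbiased estimates \<open>a, a'\<close> of \<open>p - q\<close>, so
  \<open>\<Sum>x. w x * a x * a' x\<close> is an unbiased estimate of \<open>\<Sum>x. w x * (p x - q x)\<^sup>2\<close> without any
  correction term. The third histogram of the larger group supplies the weights
  \<open>w x = 1 / (l + max 0 (e x))\<close>, which play the role of flattening: on average
  \<open>\<Sum>x. 1 / w x = O(k * l)\<close>, so by Cauchy-Schwarz the signal is of order \<open>\<alpha>\<^sup>2 / (k * l)\<close>, while
  \<open>\<Sum>x. (w x * q x)\<^sup>2\<close> stays of order \<open>k + 1 / (M * l\<^sup>2)\<close>. Taking for \<open>l\<close> the maximum of \<open>1 / k\<close>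
  and the noise level of the third histogram, Chebyshev's inequality yields the stated sample size.
  When \<open>ln (1/\<delta>) \<ge> 1\<close> the first two terms of the bound already suffice.
\<close>

section \<open>Expectations over finitely supported distributions\<close>

text \<open>A single user can carry all the noise because privacy is demanded of the shuffled output
  only. Changing a sample can move one unit between two cells; the comparison passes through the
  output in which that user is silent, so a cell must hide a shift by one with half of the privacy
  budget.

  The number of users is fixed, so the counts of different cells are dependent. The variance
  analysis uses only that the covariance matrix of an estimate is dominated by a diagonal one. For a
  statistic bilinear in two independent estimates this is enough.

  The weights see samples of \<open>q\<close> alone. They control \<open>w x * q x\<close> but not
  \<open>w x * p x\<close>; the excess of \<open>p\<close> over \<open>q\<close> is charged to the
  signal.

  The ratio \<open>r = (\<epsilon>1 / \<epsilon>2)^2\<close> of the group sizes balances the noise: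
  in the second group its variance is \<open>r\<close> times larger, yet after division by the
  squared sample size it is smaller by a factor of about \<open>r\<close>. The larger sample also
  improves the weights through the term \<open>1 / (M * l^2)\<close>, which is the source of the
  term of order k^(2/3).\<close>

abbreviation expect :: "'a pmf \<Rightarrow> ('a \<Rightarrow> real) \<Rightarrow> real" where
  "expect p f \<equiv> measure_pmf.expectation p f"

lemma expect_add:
  assumes "finite (set_pmf p)"
  shows "expect p (\<lambda>x. f x + g x) = expect p f + expect p g"
  by (intro Bochner_Integration.integral_add integrable_measure_pmf_finite assms)

lemma expect_diff:
  assumes "finite (set_pmf p)"
  shows "expect p (\<lambda>x. f x - g x) = expect p f - expect p g"
  by (intro Bochner_Integration.integral_diff integrable_measure_pmf_finite assms)

lemma expect_sum:
  assumes "finite (set_pmf p)"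
  shows "expect p (\<lambda>x. \<Sum>i\<in>I. f i x) = (\<Sum>i\<in>I. expect p (f i))"
  by (intro Bochner_Integration.integral_sum integrable_measure_pmf_finite assms)

lemma expect_mono:
  assumes "finite (set_pmf p)" "\<And>x. x \<in> set_pmf p \<Longrightarrow> f x \<le> g x"
  shows "expect p f \<le> expect p g"
  by (intro integral_mono_AE integrable_measure_pmf_finite assms(1))
     (use assms(2) in \<open>auto simp: AE_measure_pmf_iff\<close>)

lemma expect_cong:
  assumes "\<And>x. x \<in> set_pmf p \<Longrightarrow> f x = g x"
  shows "expect p f = expect p g"
  by (rule integral_cong_AE) (use assms in \<open>auto simp: AE_measure_pmf_iff\<close>)

lemma expect_bind:
  assumes "finite (set_pmf p)" "\<And>x. x \<in> set_pmf p \<Longrightarrow> finite (set_pmf (f x))"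
  shows "expect (bind_pmf p f) h = expect p (\<lambda>x. expect (f x) h)"
proof -
  have "expect (bind_pmf p f) h = (\<Sum>a\<in>set_pmf p. pmf p a *\<^sub>R expect (f a) h)"
    using assms by (intro pmf_expectation_bind) auto
  also have "\<dots> = expect p (\<lambda>x. expect (f x) h)"
    using assms(1) by (subst integral_measure_pmf[of "set_pmf p"]) auto
  finally show ?thesis .
qed

lemma expect_pair:
  assumes "finite (set_pmf p)" "finite (set_pmf q)"
  shows "expect (pair_pmf p q) h = expect p (\<lambda>x. expect q (\<lambda>y. h (x, y)))"
  using assms by (simp add: pair_pmf_def expect_bind)

lemma prob_eq_expect: "measure_pmf.prob p S = expect p (indicator S)"
  by simp

lemma prob_bind:
  assumes "finite (set_pmf p)" "\<And>x. x \<in> set_pmf p \<Longrightarrow> finite (set_pmf (f x))"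
  shows "measure_pmf.prob (bind_pmf p f) S = expect p (\<lambda>x. measure_pmf.prob (f x) S)"
  unfolding prob_eq_expect by (rule expect_bind) (use assms in auto)

lemma expect_square_ge:
  assumes "finite (set_pmf p)"
  shows "(expect p f)\<^sup>2 \<le> expect p (\<lambda>x. (f x)\<^sup>2)"
proof -
  have "0 \<le> expect p (\<lambda>x. (f x - expect p f)\<^sup>2)" by simp
  also have "(\<lambda>x. (f x - expect p f)\<^sup>2) = (\<lambda>x. (f x)\<^sup>2 - 2 * expect p f * f x + (expect p f)\<^sup>2)"
    by (auto simp: power2_eq_square algebra_simps)
  also have "expect p \<dots> = expect p (\<lambda>x. (f x)\<^sup>2) - (expect p f)\<^sup>2"
    using assms by (simp add: expect_add expect_diff power2_eq_square)
  finally show ?thesis by simp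
qed

lemma expect_abs_le_sqrt:
  assumes "finite (set_pmf p)"
  shows "expect p (\<lambda>x. \<bar>f x\<bar>) \<le> sqrt (expect p (\<lambda>x. (f x)\<^sup>2))"
  using expect_square_ge[OF assms, of "\<lambda>x. \<bar>f x\<bar>"] by (intro real_le_rsqrt) simp

lemma markov:
  assumes "finite (set_pmf p)" "\<And>x. x \<in> set_pmf p \<Longrightarrow> 0 \<le> f x" "c > 0"
  shows "measure_pmf.prob p {x. f x \<ge> c} \<le> expect p f / c"
proof -
  have "c * measure_pmf.prob p {x. f x \<ge> c} = expect p (\<lambda>x. c * indicator {x. f x \<ge> c} x)"
    by simp
  also have "\<dots> \<le> expect p f"
    using assms by (intro expect_mono) (auto simp: indicator_def)
  finally show ?thesis using assms(3) by (simp add: field_simps)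
qed

lemma chebyshev:
  assumes "finite (set_pmf p)" "c > 0"
  shows "measure_pmf.prob p {x. \<bar>f x - a\<bar> \<ge> c} \<le> expect p (\<lambda>x. (f x - a)\<^sup>2) / c\<^sup>2"
proof -
  have "{x. \<bar>f x - a\<bar> \<ge> c} = {x. (f x - a)\<^sup>2 \<ge> c\<^sup>2}"
    using assms(2) by (auto simp: abs_le_square_iff[symmetric])
  then show ?thesis using markov[of p "\<lambda>x. (f x - a)\<^sup>2" "c\<^sup>2"] assms by auto
qed

section \<open>Product distributions: second moments and resampling of coordinates\<close>

lemma finite_set_Pi_pmf:
  assumes "finite A" "\<And>x. x \<in> A \<Longrightarrow> finite (set_pmf (p x))"
  shows "finite (set_pmf (Pi_pmf A d p))"
proof (rule finite_subset)
  show "set_pmf (Pi_pmf A d p) \<subseteq> PiE_dflt A d (set_pmf \<circ> p)"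
    by (rule set_Pi_pmf_subset'[OF assms(1)])
  show "finite (PiE_dflt A d (set_pmf \<circ> p))" using assms by (intro finite_PiE_dflt) auto
qed

lemma expect_Pi_insert:
  assumes "finite A" "x \<notin> A" "\<And>y. y \<in> insert x A \<Longrightarrow> finite (set_pmf (p y))"
  shows "expect (Pi_pmf (insert x A) d p) h = expect (p x) (\<lambda>y. expect (Pi_pmf A d p) (\<lambda>f. h (f(x := y))))"
  using assms by (simp add: Pi_pmf_insert' expect_bind finite_set_Pi_pmf)

lemma expect_Pi_component:
  assumes "finite A" "x \<in> A"
  shows "expect (Pi_pmf A d p) (\<lambda>f. h (f x)) = expect (p x) h"
proof -
  have "expect (map_pmf (\<lambda>f. f x) (Pi_pmf A d p)) h = expect (p x) h"
    using assms by (simp add: Pi_pmf_component)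
  then show ?thesis by simp
qed

text \<open>Cross terms vanish by independence. The sum ranges over a subset \<open>B\<close>
  because a histogram reads only one class of users and one class of noise cells.\<close>

lemma expect_centred_sum_square:
  fixes g :: "'a \<Rightarrow> 'b \<Rightarrow> real"
  assumes "finite A" "B \<subseteq> A" "\<And>i. i \<in> A \<Longrightarrow> finite (set_pmf (p i))"
    and "\<And>i. i \<in> B \<Longrightarrow> expect (p i) (g i) = 0"
  shows "expect (Pi_pmf A d p) (\<lambda>f. (\<Sum>i\<in>B. g i (f i))\<^sup>2) = (\<Sum>i\<in>B. expect (p i) (\<lambda>y. (g i y)\<^sup>2))"
  using assms
proof (induction A arbitrary: B rule: finite_induct)
  case empty
  then show ?case by simp
next
  case (insert x A)
  show ?case
  proof (cases "x \<in> B")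
    case False
    have *: "B \<subseteq> A" using False insert.prems by auto
    have **: "(\<Sum>i\<in>B. g i ((f(x := y)) i)) = (\<Sum>i\<in>B. g i (f i))" for f y
      using False by (intro sum.cong) auto
    have "expect (Pi_pmf (insert x A) d p) (\<lambda>f. (\<Sum>i\<in>B. g i (f i))\<^sup>2)
        = expect (p x) (\<lambda>y. expect (Pi_pmf A d p) (\<lambda>f. (\<Sum>i\<in>B. g i ((f(x := y)) i))\<^sup>2))"
      by (rule expect_Pi_insert) (use insert.prems insert.hyps in auto)
    also have "\<dots> = expect (Pi_pmf A d p) (\<lambda>f. (\<Sum>i\<in>B. g i (f i))\<^sup>2)"
      unfolding ** by simp
    also have "\<dots> = (\<Sum>i\<in>B. expect (p i) (\<lambda>y. (g i y)\<^sup>2))"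
      by (rule insert.IH) (use * insert.prems in auto)
    finally show ?thesis .
  next
    case True
    define B' where "B' = B - {x}"
    have B': "B' \<subseteq> A" "x \<notin> B'" "B = insert x B'" "finite B'"
      using True insert.prems insert.hyps finite_subset[of B' A] unfolding B'_def by auto
    have fin: "finite (set_pmf (Pi_pmf A d p))"
      by (rule finite_set_Pi_pmf) (use insert.prems insert.hyps in auto)
    have finx: "finite (set_pmf (p x))" using insert.prems by auto
    let ?S = "\<lambda>f. \<Sum>i\<in>B'. g i (f i)"
    have eq: "(\<Sum>i\<in>B. g i ((f(x := y)) i)) = g x y + ?S f" for f y
    proof -
      have "(\<Sum>i\<in>B'. g i ((f(x := y)) i)) = ?S f" using B'(2) by (intro sum.cong) auto
      then show ?thesis using B' by simp
    qed
    have IH: "expect (Pi_pmf A d p) (\<lambda>f. (?S f)\<^sup>2) = (\<Sum>i\<in>B'. expect (p i) (\<lambda>y. (g i y)\<^sup>2))"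
      by (rule insert.IH) (use B' insert.prems in auto)
    have "expect (Pi_pmf (insert x A) d p) (\<lambda>f. (\<Sum>i\<in>B. g i (f i))\<^sup>2)
        = expect (p x) (\<lambda>y. expect (Pi_pmf A d p) (\<lambda>f. (g x y + ?S f)\<^sup>2))"
      unfolding eq[symmetric] by (rule expect_Pi_insert) (use insert.prems insert.hyps in auto)
    also have "\<dots> = expect (p x) (\<lambda>y. (g x y)\<^sup>2 + expect (Pi_pmf A d p) ?S * 2 * g x y
        + expect (Pi_pmf A d p) (\<lambda>f. (?S f)\<^sup>2))"
      by (intro expect_cong) (use fin in \<open>simp add: power2_sum expect_add mult_ac\<close>)
    also have "\<dots> = expect (p x) (\<lambda>y. (g x y)\<^sup>2) + expect (Pi_pmf A d p) ?S * 2 * expect (p x) (g x)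
        + expect (Pi_pmf A d p) (\<lambda>f. (?S f)\<^sup>2)"
      using finx by (simp add: expect_add)
    finally show ?thesis using IH insert.prems True B' by simp
  qed
qed

text \<open>Taking the coordinates in \<open>P\<close> from one copy and the others from an
  independent copy does not change a product law. Independence of functions of disjoint sets of
  coordinates is derived from this.\<close>

lemma Pi_pmf_split:
  assumes "finite A"
  shows "Pi_pmf A d p = map_pmf (\<lambda>(f, g) i. if P i then f i else g i) (pair_pmf (Pi_pmf A d p) (Pi_pmf A d p))"
  using assms
proof (induction A rule: finite_induct)
  case empty
  then show ?case by (simp)
next
  case (insert x A)
  let ?P = "Pi_pmf A d p"
  let ?h = "\<lambda>f g i. if P i then f i else g i"
  have eq: "?h (f(x := y)) (g(x := z)) = (?h f g)(x := if P x then y else z)" for f g y z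
    by auto
  have "map_pmf (\<lambda>(f, g) i. if P i then f i else g i) (pair_pmf (Pi_pmf (insert x A) d p) (Pi_pmf (insert x A) d p))
     = do {y \<leftarrow> p x; f \<leftarrow> ?P; z \<leftarrow> p x; g \<leftarrow> ?P; return_pmf (?h (f(x := y)) (g(x := z)))}"
    using insert.hyps by (simp add: Pi_pmf_insert' pair_pmf_def map_bind_pmf bind_assoc_pmf bind_return_pmf)
  also have "\<dots> = do {y \<leftarrow> p x; z \<leftarrow> p x; f \<leftarrow> ?P; g \<leftarrow> ?P; return_pmf ((?h f g)(x := if P x then y else z))}"
    unfolding eq by (subst (2) bind_commute_pmf) simp
  also have "\<dots> = do {y \<leftarrow> p x; f \<leftarrow> ?P; g \<leftarrow> ?P; return_pmf ((?h f g)(x := y))}"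
    by (cases "P x") simp_all
  also have "\<dots> = do {y \<leftarrow> p x; f' \<leftarrow> map_pmf (\<lambda>(f, g). ?h f g) (pair_pmf ?P ?P); return_pmf (f'(x := y))}"
    by (simp add: pair_pmf_def map_bind_pmf bind_map_pmf bind_assoc_pmf bind_return_pmf)
  also have "\<dots> = Pi_pmf (insert x A) d p"
    unfolding insert.IH[symmetric] using insert.hyps by (rule Pi_pmf_insert'[symmetric])
  finally show ?case by simp
qed

section \<open>The shuffler reveals exactly the multiset of messages\<close>

lemma shuffle_messages_cong:
  assumes "mset xs = mset ys"
  shows "shuffle_messages xs = shuffle_messages ys"
proof -
  obtain s where s: "s permutes {..<length ys}" "permute_list s ys = xs"
    using mset_eq_permutation[OF assms] by blast
  have len: "length xs = length ys" using assms mset_eq_length by blast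
  let ?P = "{\<pi>. \<pi> permutes {..<length ys}}"
  \<comment> \<open>Composition with the fixed permutation \<open>s\<close> that turns
    \<open>ys\<close> into \<open>xs\<close> preserves the uniform law on permutations.\<close>
  have bij: "bij_betw (\<lambda>\<pi>. s \<circ> \<pi>) ?P ?P"
  proof (rule bij_betwI[where g = "\<lambda>\<pi>. inv s \<circ> \<pi>"])
    show "(\<lambda>\<pi>. s \<circ> \<pi>) \<in> ?P \<rightarrow> ?P" using s permutes_compose by blast
    show "(\<lambda>\<pi>. inv s \<circ> \<pi>) \<in> ?P \<rightarrow> ?P" using s permutes_compose permutes_inv by blast
  qed (use permutes_inv_o[OF s(1)] in \<open>auto simp: o_assoc\<close>)
  have "finite ?P" "?P \<noteq> {}" by (auto intro: exI[of _ id] permutes_id finite_permutations)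
  then have mp: "map_pmf (\<lambda>\<pi>. s \<circ> \<pi>) (pmf_of_set ?P) = pmf_of_set ?P"
    by (intro map_pmf_of_set_bij_betw[OF bij])
  have "shuffle_messages ys = map_pmf (\<lambda>\<pi>. permute_list \<pi> ys) (map_pmf (\<lambda>\<pi>. s \<circ> \<pi>) (pmf_of_set ?P))"
    by (simp only: mp shuffle_messages_def)
  also have "\<dots> = map_pmf (\<lambda>\<pi>. permute_list (s \<circ> \<pi>) ys) (pmf_of_set ?P)"
    by (simp only: map_pmf_comp)
  also have "\<dots> = map_pmf (\<lambda>\<pi>. permute_list \<pi> xs) (pmf_of_set ?P)"
    using \<open>finite ?P\<close> \<open>?P \<noteq> {}\<close> s by (intro map_pmf_cong) (auto simp: permute_list_compose)
  finally show ?thesis by (simp add: shuffle_messages_def len)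
qed

lemma finite_set_shuffle_messages: "finite (set_pmf (shuffle_messages ms))"
proof -
  have "{\<pi>. \<pi> permutes {..<length ms}} \<noteq> {}" using permutes_id[of "{..<length ms}"] by blast
  then show ?thesis by (simp add: shuffle_messages_def finite_permutations)
qed

lemma map_count_shuffle_messages:
  "map_pmf (count_list) (shuffle_messages ms) = return_pmf (count_list ms)"
proof -
  have ne: "{\<pi>. \<pi> permutes {..<length ms}} \<noteq> {}" "finite {\<pi>. \<pi> permutes {..<length ms}}"
    by (auto intro: exI[of _ id] permutes_id finite_permutations)
  have "map_pmf count_list (shuffle_messages ms)
      = map_pmf (\<lambda>_. count_list ms) (pmf_of_set {\<pi>. \<pi> permutes {..<length ms}})"
    unfolding shuffle_messages_def map_pmf_comp using ne
    by (intro map_pmf_cong) (auto simp flip: count_mset simp: fun_eq_iff)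
  then show ?thesis by simp
qed

section \<open>The weighted bilinear statistic\<close>

text \<open>With all coefficient vectors \<open>a\<close> allowed, this says that on
  \<open>I\<close> the mean is \<open>\<mu>\<close> and the covariance matrix is below the diagonal
  matrix with entries \<open>D\<close> in the Loewner order. Variances of single cells would not
  suffice, as the cells are dependent.\<close>

definition estimates :: "'a set \<Rightarrow> ('a \<Rightarrow> real) pmf \<Rightarrow> ('a \<Rightarrow> real) \<Rightarrow> ('a \<Rightarrow> real) \<Rightarrow> bool" where
  "estimates I P \<mu> D \<longleftrightarrow> finite (set_pmf P) \<and>
     (\<forall>a. expect P (\<lambda>e. \<Sum>x\<in>I. a x * (e x - \<mu> x)) = 0 \<and>
          expect P (\<lambda>e. (\<Sum>x\<in>I. a x * (e x - \<mu> x))\<^sup>2) \<le> (\<Sum>x\<in>I. (a x)\<^sup>2 * D x))"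

lemma estimates_finite: "estimates I P \<mu> D \<Longrightarrow> finite (set_pmf P)"
  by (simp add: estimates_def)

lemma estimates_mean:
  "estimates I P \<mu> D \<Longrightarrow> expect P (\<lambda>e. \<Sum>x\<in>I. a x * (e x - \<mu> x)) = 0"
  by (simp add: estimates_def)

lemma estimates_variance:
  "estimates I P \<mu> D \<Longrightarrow> expect P (\<lambda>e. (\<Sum>x\<in>I. a x * (e x - \<mu> x))\<^sup>2) \<le> (\<Sum>x\<in>I. (a x)\<^sup>2 * D x)"
  by (simp add: estimates_def)

lemma estimates_mono:
  assumes "estimates I P \<mu> D" "\<And>x. x \<in> I \<Longrightarrow> D x \<le> D' x"
  shows "estimates I P \<mu> D'"
proof -
  have "(\<Sum>x\<in>I. (a x)\<^sup>2 * D x) \<le> (\<Sum>x\<in>I. (a x)\<^sup>2 * D' x)" for a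
    using assms(2) by (intro sum_mono mult_left_mono) auto
  then show ?thesis using assms(1) unfolding estimates_def by (meson order_trans)
qed

lemma estimates_point:
  assumes "estimates I P \<mu> D" "finite I" "x \<in> I"
  shows "expect P (\<lambda>e. e x) = \<mu> x" "expect P (\<lambda>e. (e x - \<mu> x)\<^sup>2) \<le> D x"
proof -
  let ?a = "\<lambda>y. if y = x then 1 else 0 :: real"
  have 1: "(\<Sum>y\<in>I. ?a y * (e y - \<mu> y)) = e x - \<mu> x" for e :: "'a \<Rightarrow> real"
  proof -
    have "(\<Sum>y\<in>I. ?a y * (e y - \<mu> y)) = (\<Sum>y\<in>I. if y = x then e y - \<mu> y else 0)"
      by (intro sum.cong) auto
    then show ?thesis using assms by simp
  qed
  have 2: "(\<Sum>y\<in>I. (?a y)\<^sup>2 * D y) = D x"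
  proof -
    have "(\<Sum>y\<in>I. (?a y)\<^sup>2 * D y) = (\<Sum>y\<in>I. if y = x then D y else 0)"
      by (intro sum.cong) auto
    then show ?thesis using assms by simp
  qed
  show "expect P (\<lambda>e. e x) = \<mu> x"
    using estimates_mean[OF assms(1), of ?a] estimates_finite[OF assms(1)]
    unfolding 1 by (simp add: expect_diff)
  show "expect P (\<lambda>e. (e x - \<mu> x)\<^sup>2) \<le> D x"
    using estimates_variance[OF assms(1), of ?a] unfolding 1 2 .
qed

lemma estimates_second_moment:
  assumes "estimates I P \<mu> D" "finite I" "x \<in> I"
  shows "expect P (\<lambda>e. (e x)\<^sup>2) \<le> D x + (\<mu> x)\<^sup>2"
proof -
  have "(\<lambda>e. (e x)\<^sup>2) = (\<lambda>e. (e x - \<mu> x)\<^sup>2 + 2 * \<mu> x * e x - (\<mu> x)\<^sup>2)"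
    by (auto simp: power2_eq_square algebra_simps)
  then have "expect P (\<lambda>e. (e x)\<^sup>2) = expect P (\<lambda>e. (e x - \<mu> x)\<^sup>2) + 2 * \<mu> x * \<mu> x - (\<mu> x)\<^sup>2"
    using estimates_finite[OF assms(1)] estimates_point(1)[OF assms] by (simp add: expect_add expect_diff)
  then show ?thesis using estimates_point(2)[OF assms] by (simp add: power2_eq_square)
qed

lemma expect_pair_sum_square:
  assumes "finite (set_pmf P)" "finite (set_pmf Q)" "expect P f = 0" "expect Q g = 0"
  shows "expect (pair_pmf P Q) (\<lambda>(a, b). (f a + g b)\<^sup>2) = expect P (\<lambda>a. (f a)\<^sup>2) + expect Q (\<lambda>b. (g b)\<^sup>2)"
proof -
  have "expect Q (\<lambda>b. (f a + g b)\<^sup>2) = (f a)\<^sup>2 + expect Q (\<lambda>b. (g b)\<^sup>2)" for a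
  proof -
    have "(\<lambda>b. (f a + g b)\<^sup>2) = (\<lambda>b. (f a)\<^sup>2 + (g b)\<^sup>2 + 2 * f a * g b)"
      by (auto simp: power2_sum)
    then show ?thesis using assms by (simp add: expect_add)
  qed
  then show ?thesis using assms by (simp add: expect_pair expect_add)
qed

lemma estimates_diff:
  assumes "estimates I P \<mu> D" "estimates I Q \<nu> E"
  shows "estimates I (map_pmf (\<lambda>(e, f) x. e x - f x) (pair_pmf P Q)) (\<lambda>x. \<mu> x - \<nu> x) (\<lambda>x. D x + E x)"
proof -
  note fin = estimates_finite[OF assms(1)] estimates_finite[OF assms(2)]
  have eq: "(\<Sum>x\<in>I. a x * ((e x - f x) - (\<mu> x - \<nu> x)))
      = (\<Sum>x\<in>I. a x * (e x - \<mu> x)) + (\<Sum>x\<in>I. - a x * (f x - \<nu> x))" for a e f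
    by (simp add: sum.distrib[symmetric] algebra_simps)
  have 1: "expect (pair_pmf P Q) (\<lambda>(e, f). (\<Sum>x\<in>I. a x * (e x - \<mu> x)) + (\<Sum>x\<in>I. - a x * (f x - \<nu> x))) = 0" for a
    using fin estimates_mean[OF assms(1), of a] estimates_mean[OF assms(2), of "\<lambda>x. - a x"]
    by (simp add: expect_pair expect_add)
  have 2: "expect (pair_pmf P Q) (\<lambda>(e, f). ((\<Sum>x\<in>I. a x * (e x - \<mu> x)) + (\<Sum>x\<in>I. - a x * (f x - \<nu> x)))\<^sup>2)
      \<le> (\<Sum>x\<in>I. (a x)\<^sup>2 * (D x + E x))" for a
  proof -
    have "expect (pair_pmf P Q) (\<lambda>(e, f). ((\<Sum>x\<in>I. a x * (e x - \<mu> x)) + (\<Sum>x\<in>I. - a x * (f x - \<nu> x)))\<^sup>2)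
       = expect P (\<lambda>e. (\<Sum>x\<in>I. a x * (e x - \<mu> x))\<^sup>2) + expect Q (\<lambda>f. (\<Sum>x\<in>I. - a x * (f x - \<nu> x))\<^sup>2)"
      by (rule expect_pair_sum_square) (use fin estimates_mean[OF assms(1), of a] estimates_mean[OF assms(2), of "\<lambda>x. - a x"] in auto)
    also have "\<dots> \<le> (\<Sum>x\<in>I. (a x)\<^sup>2 * D x) + (\<Sum>x\<in>I. (- a x)\<^sup>2 * E x)"
      by (intro add_mono estimates_variance assms)
    finally show ?thesis by (simp add: sum.distrib distrib_left)
  qed
  show ?thesis unfolding estimates_def
    using fin 1 2 by (simp add: case_prod_unfold eq)
qed

text \<open>Given \<open>a\<close>, the error is a linear functional of the centred
  \<open>a'\<close> with coefficients \<open>w x * a x\<close>, plus \<open>c a\<close>, which is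
  linear in the centred \<open>a\<close>. The domination by \<open>D\<close> is applied first to
  \<open>a'\<close> and then to \<open>a\<close>.\<close>

lemma bilinear_variance:
  assumes A: "estimates I A \<Delta> D" and A': "estimates I A' \<Delta> D" and I: "finite I"
    and D: "\<And>x. x \<in> I \<Longrightarrow> 0 \<le> D x"
  shows "expect (pair_pmf A A') (\<lambda>(a, a'). ((\<Sum>x\<in>I. w x * a x * a' x) - (\<Sum>x\<in>I. w x * (\<Delta> x)\<^sup>2))\<^sup>2)
     \<le> (\<Sum>x\<in>I. (w x * D x)\<^sup>2) + 2 * (\<Sum>x\<in>I. (w x)\<^sup>2 * D x * (\<Delta> x)\<^sup>2)"
proof -
  note fin = estimates_finite[OF A] estimates_finite[OF A']
  define c where "c = (\<lambda>a. \<Sum>x\<in>I. (w x * \<Delta> x) * (a x - \<Delta> x))"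
  have eq: "(\<Sum>x\<in>I. w x * a x * a' x) - (\<Sum>x\<in>I. w x * (\<Delta> x)\<^sup>2)
      = (\<Sum>x\<in>I. (w x * a x) * (a' x - \<Delta> x)) + c a" for a a'
    unfolding c_def by (simp add: sum.distrib[symmetric] sum_subtractf[symmetric] algebra_simps power2_eq_square)
  have inner: "expect A' (\<lambda>a'. ((\<Sum>x\<in>I. (w x * a x) * (a' x - \<Delta> x)) + c a)\<^sup>2)
      \<le> (\<Sum>x\<in>I. (w x)\<^sup>2 * D x * (a x)\<^sup>2) + (c a)\<^sup>2" for a
  proof -
    let ?f = "\<lambda>a'. \<Sum>x\<in>I. (w x * a x) * (a' x - \<Delta> x)"
    have "(\<lambda>a'. (?f a' + c a)\<^sup>2) = (\<lambda>a'. (?f a')\<^sup>2 + (c a)\<^sup>2 + 2 * c a * ?f a')"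
      by (auto simp: power2_sum)
    then have "expect A' (\<lambda>a'. (?f a' + c a)\<^sup>2) = expect A' (\<lambda>a'. (?f a')\<^sup>2) + (c a)\<^sup>2"
      using fin estimates_mean[OF A', of "\<lambda>x. w x * a x"] by (simp add: expect_add)
    also have "expect A' (\<lambda>a'. (?f a')\<^sup>2) \<le> (\<Sum>x\<in>I. (w x * a x)\<^sup>2 * D x)"
      by (rule estimates_variance[OF A'])
    finally show ?thesis by (simp add: power_mult_distrib mult_ac)
  qed
  have "expect (pair_pmf A A') (\<lambda>(a, a'). ((\<Sum>x\<in>I. w x * a x * a' x) - (\<Sum>x\<in>I. w x * (\<Delta> x)\<^sup>2))\<^sup>2)
      = expect A (\<lambda>a. expect A' (\<lambda>a'. ((\<Sum>x\<in>I. (w x * a x) * (a' x - \<Delta> x)) + c a)\<^sup>2))"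
    using fin unfolding eq by (simp add: expect_pair)
  also have "\<dots> \<le> expect A (\<lambda>a. (\<Sum>x\<in>I. (w x)\<^sup>2 * D x * (a x)\<^sup>2) + (c a)\<^sup>2)"
    using fin inner by (intro expect_mono) auto
  also have "\<dots> = (\<Sum>x\<in>I. (w x)\<^sup>2 * D x * expect A (\<lambda>a. (a x)\<^sup>2)) + expect A (\<lambda>a. (c a)\<^sup>2)"
    using fin by (simp add: expect_add expect_sum)
  also have "\<dots> \<le> (\<Sum>x\<in>I. (w x)\<^sup>2 * D x * (D x + (\<Delta> x)\<^sup>2)) + (\<Sum>x\<in>I. (w x * \<Delta> x)\<^sup>2 * D x)"
    unfolding c_def using D I
    by (intro add_mono sum_mono mult_left_mono estimates_second_moment[OF A] estimates_variance[OF A]) auto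
  also have "\<dots> = (\<Sum>x\<in>I. (w x * D x)\<^sup>2) + 2 * (\<Sum>x\<in>I. (w x)\<^sup>2 * D x * (\<Delta> x)\<^sup>2)"
    by (simp add: sum_distrib_left sum.distrib[symmetric] algebra_simps power2_eq_square)
  finally show ?thesis .
qed

section \<open>Random weights and the error probability of the weighted test\<close>

definition weight :: "real \<Rightarrow> ('a \<Rightarrow> real) \<Rightarrow> 'a \<Rightarrow> real" where
  "weight l e x = 1 / (l + max 0 (e x))"

lemma weight_bounds:
  assumes "l > 0"
  shows "weight l e x > 0" "weight l e x \<le> 1 / l"
  using assms by (auto simp: weight_def field_simps)

text \<open>The denominator falls short of \<open>q\<close> by at most
  \<open>\<bar>e x - q\<bar>\<close>, and it is never below \<open>l\<close>, even when noise makes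
  \<open>e x\<close> negative.\<close>

lemma weight_mult_le:
  assumes "l > 0" "q \<ge> 0"
  shows "weight l e x * q \<le> 1 + \<bar>e x - q\<bar> / l"
proof -
  let ?m = "l + max 0 (e x)"
  have m: "?m > 0" "?m \<ge> l" using assms by auto
  have "q \<le> ?m + \<bar>e x - q\<bar>" using assms by linarith
  also have "\<bar>e x - q\<bar> = l * (\<bar>e x - q\<bar> / l)" using assms by simp
  also have "\<dots> \<le> ?m * (\<bar>e x - q\<bar> / l)" using m assms by (intro mult_right_mono) auto
  finally show ?thesis using m assms by (simp add: weight_def field_simps)
qed

lemma square_sum_le: "(a + b)\<^sup>2 \<le> 2 * a\<^sup>2 + 2 * b\<^sup>2" for a b :: real
  using zero_le_power2[of "a - b"] by (simp add: power2_eq_square algebra_simps)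

text \<open>
  Only the variance of the estimate \<open>e x\<close> enters here, so the sampling error and the added noise
  need not be distinguished, although \<open>e x\<close> can be negative.
\<close>

lemma expect_weight_square:
  assumes W: "estimates I W q D" and I: "finite I" "x \<in> I" and l: "l > 0" and q: "q x \<ge> 0"
  shows "expect W (\<lambda>e. (weight l e x * q x)\<^sup>2) \<le> 2 + 2 * D x / l\<^sup>2"
proof -
  note fin = estimates_finite[OF W]
  have "(weight l e x * q x)\<^sup>2 \<le> 2 + 2 / l\<^sup>2 * (e x - q x)\<^sup>2" for e
  proof -
    have "(weight l e x * q x)\<^sup>2 \<le> (1 + \<bar>e x - q x\<bar> / l)\<^sup>2"
      using weight_mult_le[OF l q, of e x] weight_bounds(1)[OF l, of e x] q by (intro power_mono) auto
    also have "\<dots> \<le> 2 * 1\<^sup>2 + 2 * (\<bar>e x - q x\<bar> / l)\<^sup>2"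
      by (rule square_sum_le)
    finally show ?thesis by (simp add: power_divide)
  qed
  then have "expect W (\<lambda>e. (weight l e x * q x)\<^sup>2) \<le> expect W (\<lambda>e. 2 + 2 / l\<^sup>2 * (e x - q x)\<^sup>2)"
    using fin by (intro expect_mono) auto
  also have "\<dots> = 2 + 2 / l\<^sup>2 * expect W (\<lambda>e. (e x - q x)\<^sup>2)"
    using fin by (simp add: expect_add)
  also have "\<dots> \<le> 2 + 2 / l\<^sup>2 * D x"
    by (intro add_left_mono mult_left_mono estimates_point(2)[OF W I]) auto
  finally show ?thesis by simp
qed
text \<open>Since \<open>l^2\<close> bounds the noise variance of the histogram behind the weights,
  that noise costs only a constant per cell in the first sum; the sampling part
  \<open>q x / M\<close> sums to the extra \<open>2 / (M * l^2)\<close>. In the second sum the total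
  mass of \<open>q\<close> is absorbed by \<open>card I * l \<ge> 1\<close>.\<close>

lemma expect_weights:
  fixes l M :: real
  assumes W: "estimates I W q (\<lambda>x. q x / M + l\<^sup>2)" and I: "finite I" and l: "l > 0" and M: "M > 0"
    and q: "\<And>x. x \<in> I \<Longrightarrow> q x \<ge> 0" "sum q I \<le> 1"
    and pos: "\<And>x. x \<in> I \<Longrightarrow> expect W (\<lambda>e. max 0 (e x)) \<le> q x + l" and kl: "card I * l \<ge> 1"
  shows "expect W (\<lambda>e. \<Sum>x\<in>I. (weight l e x * q x)\<^sup>2) \<le> 4 * card I + 2 / (M * l\<^sup>2)"
    and "expect W (\<lambda>e. \<Sum>x\<in>I. 1 / weight l e x) \<le> 3 * (card I * l)"
proof -
  note fin = estimates_finite[OF W]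
  have "expect W (\<lambda>e. \<Sum>x\<in>I. (weight l e x * q x)\<^sup>2) = (\<Sum>x\<in>I. expect W (\<lambda>e. (weight l e x * q x)\<^sup>2))"
    by (rule expect_sum[OF fin])
  also have "\<dots> \<le> (\<Sum>x\<in>I. 2 + 2 * (q x / M + l\<^sup>2) / l\<^sup>2)"
    by (intro sum_mono expect_weight_square[OF W I _ l] q)
  also have "\<dots> = (\<Sum>x\<in>I. 4 + 2 / (M * l\<^sup>2) * q x)"
    using l M by (intro sum.cong) (auto simp: field_simps)
  also have "\<dots> = 4 * card I + 2 / (M * l\<^sup>2) * sum q I"
    by (simp add: sum.distrib sum_distrib_left)
  also have "\<dots> \<le> 4 * card I + 2 / (M * l\<^sup>2) * 1"
    using l M by (intro add_left_mono mult_left_mono q) auto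
  finally show "expect W (\<lambda>e. \<Sum>x\<in>I. (weight l e x * q x)\<^sup>2) \<le> 4 * card I + 2 / (M * l\<^sup>2)" by simp
  have "expect W (\<lambda>e. \<Sum>x\<in>I. 1 / weight l e x) = (\<Sum>x\<in>I. l + expect W (\<lambda>e. max 0 (e x)))"
    unfolding weight_def using fin by (simp add: expect_sum expect_add)
  also have "\<dots> \<le> (\<Sum>x\<in>I. l + (q x + l))"
    by (intro sum_mono add_left_mono pos)
  also have "\<dots> = 2 * (card I * l) + sum q I" by (simp add: sum.distrib)
  finally show "expect W (\<lambda>e. \<Sum>x\<in>I. 1 / weight l e x) \<le> 3 * (card I * l)"
    using q kl by linarith
qed

definition statistic :: "'a set \<Rightarrow> real \<Rightarrow> ('a \<Rightarrow> real) \<Rightarrow> ('a \<Rightarrow> real) \<Rightarrow> ('a \<Rightarrow> real) \<Rightarrow> real" where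
  "statistic I l e a a' = (\<Sum>x\<in>I. weight l e x * a x * a' x)"

lemma signal_lower_bound:
  assumes l: "l > 0"
  shows "(\<Sum>x\<in>I. \<bar>\<Delta> x\<bar>)\<^sup>2 \<le> (\<Sum>x\<in>I. weight l e x * (\<Delta> x)\<^sup>2) * (\<Sum>x\<in>I. 1 / weight l e x)"
proof -
  have w: "weight l e x > 0" for x by (rule weight_bounds[OF l])
  have "(\<Sum>x\<in>I. \<bar>\<Delta> x\<bar>) = (\<Sum>x\<in>I. (sqrt (weight l e x) * \<bar>\<Delta> x\<bar>) * (1 / sqrt (weight l e x)))"
    using w by (intro sum.cong) (auto simp: less_imp_neq[symmetric])
  also have "\<dots>\<^sup>2 \<le> (\<Sum>x\<in>I. (sqrt (weight l e x) * \<bar>\<Delta> x\<bar>)\<^sup>2) * (\<Sum>x\<in>I. (1 / sqrt (weight l e x))\<^sup>2)"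
    by (rule Cauchy_Schwarz_ineq_sum)
  finally show ?thesis using w by (simp add: power_mult_distrib power_divide less_imp_le)
qed

lemma sum_square_le_square_sum:
  fixes f :: "'a \<Rightarrow> real"
  assumes "finite I" "\<And>x. x \<in> I \<Longrightarrow> 0 \<le> f x"
  shows "(\<Sum>x\<in>I. (f x)\<^sup>2) \<le> (\<Sum>x\<in>I. f x)\<^sup>2"
proof -
  have "(\<Sum>x\<in>I. (f x)\<^sup>2) \<le> (\<Sum>x\<in>I. f x * (\<Sum>y\<in>I. f y))"
    using assms unfolding power2_eq_square by (intro sum_mono mult_left_mono member_le_sum) auto
  then show ?thesis by (simp add: power2_eq_square sum_distrib_right)
qed

text \<open>The bound avoids \<open>weight l e x * p x\<close>, which nothing controls, by
  \<open>p x + q x \<le> 2 * q x + \<bar>\<Delta> x\<bar>\<close>. The part with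
  \<open>\<Delta>\<close> becomes a multiple of the signal \<open>S e\<close> because a weight is at
  most \<open>1 / l\<close>.\<close>

lemma statistic_variance:
  fixes p q :: "'a \<Rightarrow> real" and m s l :: real
  defines "\<Delta> \<equiv> \<lambda>x. p x - q x" and "D \<equiv> \<lambda>x. (p x + q x) / m + s"
  assumes A: "estimates I A \<Delta> D" "estimates I A' \<Delta> D" and I: "finite I"
    and nonneg: "\<And>x. x \<in> I \<Longrightarrow> 0 \<le> p x" "\<And>x. x \<in> I \<Longrightarrow> 0 \<le> q x" "0 \<le> s" and m: "m > 0" and l: "l > 0"
  defines "S \<equiv> \<lambda>e. \<Sum>x\<in>I. weight l e x * (\<Delta> x)\<^sup>2"
  shows "expect (pair_pmf A A') (\<lambda>(a, a'). (statistic I l e a a' - S e)\<^sup>2)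
    \<le> 51 * (12 * (\<Sum>x\<in>I. (weight l e x * q x)\<^sup>2) / m\<^sup>2 + 3 * S e / (l * m\<^sup>2) + 3 * card I * s\<^sup>2 / l\<^sup>2) + (S e)\<^sup>2 / 50"
proof -
  let ?w = "weight l e"
  have w: "?w x > 0" "?w x \<le> 1 / l" for x by (rule weight_bounds[OF l])+
  have D: "0 \<le> D x" if "x \<in> I" for x using nonneg that m by (auto simp: D_def)
  have V1: "(?w x * D x)\<^sup>2 \<le> 12 * (?w x * q x)\<^sup>2 / m\<^sup>2 + 3 * (?w x * (\<Delta> x)\<^sup>2) / (l * m\<^sup>2) + 3 * s\<^sup>2 / l\<^sup>2"
    if x: "x \<in> I" for x
  proof -
    have "D x \<le> 2 * q x / m + \<bar>\<Delta> x\<bar> / m + s"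
      using m by (auto simp: D_def \<Delta>_def add_divide_distrib[symmetric] intro!: divide_right_mono)
    then have "(D x)\<^sup>2 \<le> (2 * q x / m + \<bar>\<Delta> x\<bar> / m + s)\<^sup>2"
      using D[OF x] by (intro power_mono)
    also have "\<dots> \<le> 3 * ((2 * q x / m)\<^sup>2 + (\<bar>\<Delta> x\<bar> / m)\<^sup>2 + s\<^sup>2)"
    proof -
      have "(a + b + c)\<^sup>2 \<le> 3 * (a\<^sup>2 + b\<^sup>2 + c\<^sup>2)" for a b c :: real
        using zero_le_power2[of "a - b"] zero_le_power2[of "b - c"] zero_le_power2[of "a - c"]
        by (simp add: power2_eq_square algebra_simps)
      then show ?thesis .
    qed
    also have "\<dots> = 12 * (q x)\<^sup>2 / m\<^sup>2 + 3 * (\<Delta> x)\<^sup>2 / m\<^sup>2 + 3 * s\<^sup>2"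
      by (simp add: power_divide power_mult_distrib)
    finally have "(?w x * D x)\<^sup>2 \<le> (?w x)\<^sup>2 * (12 * (q x)\<^sup>2 / m\<^sup>2 + 3 * (\<Delta> x)\<^sup>2 / m\<^sup>2 + 3 * s\<^sup>2)"
      by (simp add: power_mult_distrib mult_left_mono)
    also have "\<dots> = 12 * (?w x * q x)\<^sup>2 / m\<^sup>2 + ?w x * (3 * (?w x * (\<Delta> x)\<^sup>2) / m\<^sup>2) + (?w x)\<^sup>2 * (3 * s\<^sup>2)"
      by (simp add: power_mult_distrib power2_eq_square distrib_left mult_ac)
    also have "\<dots> \<le> 12 * (?w x * q x)\<^sup>2 / m\<^sup>2 + 1 / l * (3 * (?w x * (\<Delta> x)\<^sup>2) / m\<^sup>2) + (1 / l)\<^sup>2 * (3 * s\<^sup>2)"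
      using w[of x] by (intro add_mono order_refl mult_right_mono power_mono) auto
    finally show ?thesis by (simp add: power_divide mult_ac)
  qed
  have V: "(\<Sum>x\<in>I. (?w x * D x)\<^sup>2)
      \<le> 12 * (\<Sum>x\<in>I. (?w x * q x)\<^sup>2) / m\<^sup>2 + 3 * S e / (l * m\<^sup>2) + 3 * card I * s\<^sup>2 / l\<^sup>2"
    using sum_mono[of I, OF V1] by (simp add: sum.distrib sum_distrib_left sum_divide_distrib S_def mult_ac)
  \<comment> \<open>A weighted AM-GM inequality: the share 1/50 of \<open>(S e)^2\<close> is small
    enough for Chebyshev at distance \<open>S e / 2\<close>, at the price of the factor 51 = 1 + 50
    on the other terms.\<close>
  have X: "2 * (\<Sum>x\<in>I. (?w x)\<^sup>2 * D x * (\<Delta> x)\<^sup>2) \<le> 50 * (\<Sum>x\<in>I. (?w x * D x)\<^sup>2) + (S e)\<^sup>2 / 50"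
  proof -
    have "2 * (\<Sum>x\<in>I. (?w x)\<^sup>2 * D x * (\<Delta> x)\<^sup>2) = (\<Sum>x\<in>I. 2 * ((?w x * D x) * (?w x * (\<Delta> x)\<^sup>2)))"
      by (simp add: sum_distrib_left power2_eq_square mult_ac)
    also have "\<dots> \<le> (\<Sum>x\<in>I. 50 * (?w x * D x)\<^sup>2 + (?w x * (\<Delta> x)\<^sup>2)\<^sup>2 / 50)"
    proof (rule sum_mono)
      fix x
      have "2 * (a * b) \<le> 50 * a\<^sup>2 + b\<^sup>2 / 50" for a b :: real
        using zero_le_power2[of "50 * a - b"] by (simp add: power2_eq_square algebra_simps)
      then show "2 * ((?w x * D x) * (?w x * (\<Delta> x)\<^sup>2)) \<le> 50 * (?w x * D x)\<^sup>2 + (?w x * (\<Delta> x)\<^sup>2)\<^sup>2 / 50" .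
    qed
    also have "\<dots> = 50 * (\<Sum>x\<in>I. (?w x * D x)\<^sup>2) + (\<Sum>x\<in>I. (?w x * (\<Delta> x)\<^sup>2)\<^sup>2) / 50"
      by (simp add: sum.distrib sum_distrib_left sum_divide_distrib)
    also have "(\<Sum>x\<in>I. (?w x * (\<Delta> x)\<^sup>2)\<^sup>2) \<le> (S e)\<^sup>2"
      unfolding S_def using w by (intro sum_square_le_square_sum I) (simp add: less_imp_le)
    finally show ?thesis by simp
  qed
  have "expect (pair_pmf A A') (\<lambda>(a, a'). (statistic I l e a a' - S e)\<^sup>2)
      \<le> (\<Sum>x\<in>I. (?w x * D x)\<^sup>2) + 2 * (\<Sum>x\<in>I. (?w x)\<^sup>2 * D x * (\<Delta> x)\<^sup>2)"
    unfolding statistic_def S_def using bilinear_variance[OF A I D] .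
  also have "\<dots> \<le> 51 * (\<Sum>x\<in>I. (?w x * D x)\<^sup>2) + (S e)\<^sup>2 / 50" using X by simp
  also have "\<dots> \<le> 51 * (12 * (\<Sum>x\<in>I. (?w x * q x)\<^sup>2) / m\<^sup>2 + 3 * S e / (l * m\<^sup>2) + 3 * card I * s\<^sup>2 / l\<^sup>2)
      + (S e)\<^sup>2 / 50"
    by (intro add_right_mono mult_left_mono V) simp
  finally show ?thesis .
qed

text \<open>Markov's inequality for the weights \<open>e\<close>, combined with a bound on the
  conditional error for good \<open>e\<close>. Each of the two bad events has probability at most
  1/20.\<close>

lemma prob_pair_good_event:
  assumes fin: "finite (set_pmf W)" "finite (set_pmf P)"
    and f: "\<And>e. 0 \<le> f e" "expect W f \<le> F" "F > 0" and g: "\<And>e. 0 \<le> g e" "expect W g \<le> G" "G > 0"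
    and good: "\<And>e. f e \<le> 20 * F \<Longrightarrow> g e \<le> 20 * G \<Longrightarrow> measure_pmf.prob P (B e) \<le> c" and c: "c \<ge> 0"
  shows "measure_pmf.prob (pair_pmf W P) {(e, a). a \<in> B e} \<le> 1 / 10 + c"
proof -
  have "measure_pmf.prob (pair_pmf W P) {(e, a). a \<in> B e} = expect W (\<lambda>e. measure_pmf.prob P (B e))"
  proof -
    have "(\<lambda>y. indicator {(e, a). a \<in> B e} (e, y)) = (indicator (B e) :: _ \<Rightarrow> real)" for e
      by (auto simp: indicator_def)
    then show ?thesis unfolding prob_eq_expect expect_pair[OF fin] by simp
  qed
  \<comment> \<open>The bound holds pointwise in \<open>e\<close>: for a bad \<open>e\<close> one of
    the quotients is at least 1, for a good \<open>e\<close> the summand \<open>c\<close> alone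
    suffices.\<close>
  also have "\<dots> \<le> expect W (\<lambda>e. f e / (20 * F) + g e / (20 * G) + c)"
  proof (rule expect_mono[OF fin(1)])
    fix e
    show "measure_pmf.prob P (B e) \<le> f e / (20 * F) + g e / (20 * G) + c"
    proof (cases "f e \<le> 20 * F \<and> g e \<le> 20 * G")
      case True
      then show ?thesis using good[of e] f g by (simp add: add_nonneg_nonneg add_increasing)
    next
      case False
      then have "1 \<le> f e / (20 * F) \<or> 1 \<le> g e / (20 * G)"
        using f g by (auto simp: field_simps)
      moreover have "0 \<le> f e / (20 * F)" "0 \<le> g e / (20 * G)" using f g by auto
      moreover have "measure_pmf.prob P (B e) \<le> 1" by simp
      ultimately show ?thesis using c by linarith
    qed
  qed
  also have "\<dots> = expect W f / (20 * F) + expect W g / (20 * G) + c"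
    using fin by (simp add: expect_add)
  also have "\<dots> \<le> 1 / 20 + 1 / 20 + c"
    using f g by (intro add_mono order_refl) (auto simp: field_simps)
  finally show ?thesis by simp
qed

text \<open>Given good weights, Chebyshev's inequality errs with probability 1/20 if
  \<open>p = q\<close> and 1/5 if they are far apart; with the 1/10 for bad weights both totals are
  below 1/3. The factor 240 in \<open>J1\<close> is the 12 of the variance bound times the 20 of
  Markov's inequality.\<close>

lemma tester_error:
  fixes p q :: "'a \<Rightarrow> real" and m s l M \<alpha> t :: real
  defines "\<Delta> \<equiv> \<lambda>x. p x - q x" and "D \<equiv> \<lambda>x. (p x + q x) / m + s"
  assumes A: "estimates I A \<Delta> D" "estimates I A' \<Delta> D" and I: "finite I"
    and nonneg: "\<And>x. x \<in> I \<Longrightarrow> 0 \<le> p x" "\<And>x. x \<in> I \<Longrightarrow> 0 \<le> q x" "0 \<le> s" and m: "m > 0" and l: "l > 0"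
    and W: "estimates I W q (\<lambda>x. q x / M + l\<^sup>2)" and M: "M > 0" and q: "sum q I \<le> 1"
    and pos: "\<And>x. x \<in> I \<Longrightarrow> expect W (\<lambda>e. max 0 (e x)) \<le> q x + l" and kl: "card I * l \<ge> 1"
    and \<alpha>: "\<alpha> > 0" and t: "t = \<alpha>\<^sup>2 / (30 * (card I * l))"
    and J1: "240 * (4 * card I + 2 / (M * l\<^sup>2)) / m\<^sup>2 \<le> t\<^sup>2 / 2500"
    and J2: "3 / (l * m\<^sup>2) \<le> t / 2500"
    and J3: "3 * card I * s\<^sup>2 / l\<^sup>2 \<le> t\<^sup>2 / 2500"
  shows "(\<And>x. x \<in> I \<Longrightarrow> p x = q x) \<Longrightarrow>
      measure_pmf.prob (pair_pmf W (pair_pmf A A')) {(e, a, a'). statistic I l e a a' > t} \<le> 1 / 3"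
    and "(\<Sum>x\<in>I. \<bar>p x - q x\<bar>) > 2 * \<alpha> \<Longrightarrow>
      measure_pmf.prob (pair_pmf W (pair_pmf A A')) {(e, a, a'). statistic I l e a a' \<le> t} \<le> 1 / 3"
proof -
  note fin = estimates_finite[OF W] estimates_finite[OF A(1)] estimates_finite[OF A(2)]
  let ?Q = "\<lambda>e. \<Sum>x\<in>I. (weight l e x * q x)\<^sup>2" and ?R = "\<lambda>e. \<Sum>x\<in>I. 1 / weight l e x"
  define S where "S = (\<lambda>e. \<Sum>x\<in>I. weight l e x * (\<Delta> x)\<^sup>2)"
  define F where "F = 4 * card I + 2 / (M * l\<^sup>2)"
  define G where "G = 3 * (card I * l)"
  have w: "weight l e x > 0" for e x by (rule weight_bounds[OF l])
  have S0: "S e \<ge> 0" for e unfolding S_def by (intro sum_nonneg mult_nonneg_nonneg less_imp_le[OF w]) auto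
  have F: "F > 0" unfolding F_def using M l by (auto intro!: add_nonneg_pos)
  have G: "G > 0" unfolding G_def using kl by linarith
  have t0: "t > 0" unfolding t using \<alpha> kl by (intro divide_pos_pos) auto
  have EQ: "expect W ?Q \<le> F" "expect W ?R \<le> G"
    unfolding F_def G_def using expect_weights[OF W I l M nonneg(2) q pos kl] by auto
  have R0: "0 \<le> ?R e" for e by (intro sum_nonneg divide_nonneg_nonneg less_imp_le[OF w]) auto
  have Q0: "0 \<le> ?Q e" for e by (intro sum_nonneg) auto
  let ?V = "\<lambda>e. expect (pair_pmf A A') (\<lambda>aa. ((case aa of (a, a') \<Rightarrow> statistic I l e a a') - S e)\<^sup>2)"
  have V: "?V e \<le> 51 / 2500 * (2 * t\<^sup>2 + S e * t) + (S e)\<^sup>2 / 50" if Q: "?Q e \<le> 20 * F" for e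
  proof -
    have "?V e = expect (pair_pmf A A') (\<lambda>(a, a'). (statistic I l e a a' - S e)\<^sup>2)"
      by (simp add: case_prod_unfold)
    also have "\<dots> \<le> 51 * (12 * ?Q e / m\<^sup>2 + 3 * S e / (l * m\<^sup>2) + 3 * card I * s\<^sup>2 / l\<^sup>2) + (S e)\<^sup>2 / 50"
      unfolding S_def \<Delta>_def by (rule statistic_variance) (use A I nonneg m l in \<open>auto simp: \<Delta>_def D_def\<close>)
    also have "\<dots> \<le> 51 * (t\<^sup>2 / 2500 + S e * (t / 2500) + t\<^sup>2 / 2500) + (S e)\<^sup>2 / 50"
    proof (intro add_mono mult_left_mono order_refl)
      have "12 * ?Q e / m\<^sup>2 \<le> 12 * (20 * F) / m\<^sup>2" using Q by (intro divide_right_mono mult_left_mono) auto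
      also have "\<dots> \<le> t\<^sup>2 / 2500" using J1 by (simp add: F_def)
      finally show "12 * ?Q e / m\<^sup>2 \<le> t\<^sup>2 / 2500" .
      have "3 * S e / (l * m\<^sup>2) = S e * (3 / (l * m\<^sup>2))" by simp
      also have "\<dots> \<le> S e * (t / 2500)" by (intro mult_left_mono J2 S0)
      finally show "3 * S e / (l * m\<^sup>2) \<le> S e * (t / 2500)" .
    qed (use J3 in auto)
    also have "\<dots> = 51 / 2500 * (2 * t\<^sup>2 + S e * t) + (S e)\<^sup>2 / 50" by (simp add: field_simps)
    finally show ?thesis .
  qed
  have good: "measure_pmf.prob (pair_pmf W (pair_pmf A A')) {(e, aa). aa \<in> B e} \<le> 1 / 10 + c"
    if "c \<ge> 0" "\<And>e. ?Q e \<le> 20 * F \<Longrightarrow> ?R e \<le> 20 * G \<Longrightarrow> measure_pmf.prob (pair_pmf A A') (B e) \<le> c" for B c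
    using fin F G EQ R0 Q0 that by (intro prob_pair_good_event[of W _ ?Q F ?R G]) auto
  have cheb: "measure_pmf.prob (pair_pmf A A') {aa. r \<le> \<bar>(case aa of (a, a') \<Rightarrow> statistic I l e a a') - S e\<bar>}
      \<le> ?V e / r\<^sup>2" if "r > 0" for r e
    using fin that by (intro chebyshev) auto
  show "measure_pmf.prob (pair_pmf W (pair_pmf A A')) {(e, a, a'). statistic I l e a a' > t} \<le> 1 / 3"
    if eq: "\<And>x. x \<in> I \<Longrightarrow> p x = q x"
  proof -
    have S: "S e = 0" for e using eq by (simp add: S_def \<Delta>_def)
    have "measure_pmf.prob (pair_pmf W (pair_pmf A A')) {(e, aa). aa \<in> {(a, a'). statistic I l e a a' > t}} \<le> 1 / 10 + 1 / 20"
    proof (rule good)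
      fix e assume "?Q e \<le> 20 * F"
      then have "?V e \<le> 51 / 1250 * t\<^sup>2" using V[of e] S[of e] by simp
      also have "\<dots> \<le> 1 / 20 * t\<^sup>2" by (intro mult_right_mono) auto
      finally have V': "?V e \<le> 1 / 20 * t\<^sup>2" .
      have "measure_pmf.prob (pair_pmf A A') {(a, a'). statistic I l e a a' > t}
          \<le> measure_pmf.prob (pair_pmf A A') {aa. t \<le> \<bar>(case aa of (a, a') \<Rightarrow> statistic I l e a a') - S e\<bar>}"
        using S t0 by (intro measure_pmf.finite_measure_mono) auto
      also have "\<dots> \<le> ?V e / t\<^sup>2" by (rule cheb[OF t0])
      also have "\<dots> \<le> 1 / 20" using V' t0 by (simp add: field_simps)
      finally show "measure_pmf.prob (pair_pmf A A') {(a, a'). statistic I l e a a' > t} \<le> 1 / 20" .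
    qed auto
    then show ?thesis by (simp add: case_prod_unfold)
  qed
  show "measure_pmf.prob (pair_pmf W (pair_pmf A A')) {(e, a, a'). statistic I l e a a' \<le> t} \<le> 1 / 3"
    if far: "(\<Sum>x\<in>I. \<bar>p x - q x\<bar>) > 2 * \<alpha>"
  proof -
    have "measure_pmf.prob (pair_pmf W (pair_pmf A A')) {(e, aa). aa \<in> {(a, a'). statistic I l e a a' \<le> t}} \<le> 1 / 10 + 1 / 5"
    proof (rule good)
      fix e assume Q: "?Q e \<le> 20 * F" and R: "?R e \<le> 20 * G"
      \<comment> \<open>The L1 distance is twice the total variation distance. As
        \<open>20 * G\<close> is 60 times \<open>card I * l\<close>, the signal is at least
        \<open>4 * \<alpha>^2 / (60 * (card I * l))\<close>, which is twice the threshold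
        \<open>t\<close>.\<close>
      have "(2 * \<alpha>)\<^sup>2 \<le> (\<Sum>x\<in>I. \<bar>\<Delta> x\<bar>)\<^sup>2" using far \<alpha> unfolding \<Delta>_def by (intro power_mono) auto
      also have "\<dots> \<le> S e * ?R e" unfolding S_def by (rule signal_lower_bound[OF l])
      also have "\<dots> \<le> S e * (20 * G)" by (intro mult_left_mono R S0)
      finally have "2 * t \<le> S e" using G unfolding t G_def by (simp add: field_simps)
      then have St: "S e > 0" "t \<le> S e / 2" using t0 by auto
      have "t * t \<le> (S e / 2) * (S e / 2)" by (rule mult_mono) (use St t0 in auto)
      then have "t * t \<le> S e * S e / 4" by simp
      moreover have "S e * t \<le> S e * (S e / 2)" by (rule mult_left_mono) (use St in auto)
      then have "S e * t \<le> S e * S e / 2" by simp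
      ultimately have *: "t\<^sup>2 \<le> (S e)\<^sup>2 / 4" "S e * t \<le> (S e)\<^sup>2 / 2" by (simp_all add: power2_eq_square)
      \<comment> \<open>With \<open>t \<le> S e / 2\<close> the coefficient is 51/2500 * (1/2 + 1/2)
        + 1/50 = 0.0404.\<close>
      have V': "?V e \<le> 1 / 20 * (S e)\<^sup>2"
      proof -
        have "v \<le> 1 / 20 * s" if "v \<le> 51 / 2500 * (2 * u + x) + s / 50" "u \<le> s / 4" "x \<le> s / 2" "0 \<le> s"
          for u v x s :: real
          using that by argo
        from this[OF V[OF Q] *] show ?thesis by simp
      qed
      have "measure_pmf.prob (pair_pmf A A') {(a, a'). statistic I l e a a' \<le> t}
          \<le> measure_pmf.prob (pair_pmf A A') {aa. S e / 2 \<le> \<bar>(case aa of (a, a') \<Rightarrow> statistic I l e a a') - S e\<bar>}"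
        using St by (intro measure_pmf.finite_measure_mono) auto
      also have "\<dots> \<le> ?V e / (S e / 2)\<^sup>2" using St by (intro cheb) auto
      also have "\<dots> \<le> 1 / 5" using V' St by (simp add: field_simps power2_eq_square)
      finally show "measure_pmf.prob (pair_pmf A A') {(a, a'). statistic I l e a a' \<le> t} \<le> 1 / 5" .
    qed auto
    then show ?thesis by (simp add: case_prod_unfold)
  qed
qed

section \<open>Truncated geometric noise\<close>

text \<open>Summation by parts, twice: each factor \<open>1 - r\<close> lowers the degree of the
  coefficients by one, since i^2 - (i-1)^2 = 2i - 1. The boundary terms have a favourable sign and
  are dropped.\<close>

lemma sum_geometric_squares_le:
  fixes r :: real
  assumes r: "0 \<le> r" "r < 1"
  shows "(1 - r)\<^sup>2 * (\<Sum>i=1..T. (real i)\<^sup>2 * r ^ i) \<le> 2 * (\<Sum>i=1..T. r ^ i)"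
proof -
  have 1: "(1 - r) * (\<Sum>i=1..T. real i * r ^ i) = (\<Sum>i=1..T. r ^ i) - T * r ^ (T + 1)"
  proof (induction T)
    case (Suc T)
    have "(1 - r) * (\<Sum>i=1..Suc T. real i * r ^ i) = (1 - r) * (\<Sum>i=1..T. real i * r ^ i) + (1 - r) * (Suc T * r ^ Suc T)"
      by (simp add: distrib_left)
    also have "\<dots> = (\<Sum>i=1..Suc T. r ^ i) - Suc T * r ^ (Suc T + 1)"
      unfolding Suc.IH by (simp add: algebra_simps)
    finally show ?case .
  qed simp
  have 2: "(1 - r) * (\<Sum>i=1..T. (real i)\<^sup>2 * r ^ i) = (\<Sum>i=1..T. (2 * real i - 1) * r ^ i) - (real T)\<^sup>2 * r ^ (T + 1)"
  proof (induction T)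
    case (Suc T)
    have "(1 - r) * (\<Sum>i=1..Suc T. (real i)\<^sup>2 * r ^ i)
        = (1 - r) * (\<Sum>i=1..T. (real i)\<^sup>2 * r ^ i) + (1 - r) * ((real (Suc T))\<^sup>2 * r ^ Suc T)"
      by (simp add: distrib_left)
    also have "\<dots> = (\<Sum>i=1..Suc T. (2 * real i - 1) * r ^ i) - (real (Suc T))\<^sup>2 * r ^ (Suc T + 1)"
      unfolding Suc.IH by (simp add: algebra_simps power2_eq_square)
    finally show ?case .
  qed simp
  have "(1 - r) * (\<Sum>i=1..T. (real i)\<^sup>2 * r ^ i) \<le> (\<Sum>i=1..T. (2 * real i - 1) * r ^ i)"
    unfolding 2 using r by simp
  also have "\<dots> \<le> (\<Sum>i=1..T. 2 * (real i * r ^ i))"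
    using r by (intro sum_mono) (auto simp: algebra_simps)
  finally have "(1 - r) * ((1 - r) * (\<Sum>i=1..T. (real i)\<^sup>2 * r ^ i)) \<le> (1 - r) * (\<Sum>i=1..T. 2 * (real i * r ^ i))"
    using r by (intro mult_left_mono) auto
  also have "\<dots> = 2 * ((1 - r) * (\<Sum>i=1..T. real i * r ^ i))"
    by (simp add: sum_distrib_left[symmetric])
  also have "\<dots> \<le> 2 * (\<Sum>i=1..T. r ^ i)"
    unfolding 1 using r by simp
  finally show ?thesis by (simp add: power2_eq_square mult_ac)
qed

text \<open>Differential privacy of the noise against adding 1, stated for test functions with
  values in [0,1] instead of events, because averaging over all other randomness turns an event into
  such a function.\<close>

definition shift_private :: "real \<Rightarrow> real \<Rightarrow> nat pmf \<Rightarrow> bool" where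
  "shift_private \<rho> d \<nu> \<longleftrightarrow> (\<forall>g. (\<forall>n. 0 \<le> g n \<and> g n \<le> 1) \<longrightarrow>
     expect \<nu> (\<lambda>n. g (Suc n)) \<le> exp \<rho> * expect \<nu> g + d \<and>
     expect \<nu> g \<le> exp \<rho> * expect \<nu> (\<lambda>n. g (Suc n)) + d)"

text \<open>The noise has mass proportional to \<open>exp (- \<rho> * \<bar>j - T\<bar>)\<close> on \<open>{0..2 * T}\<close>, with \<open>exp (- \<rho> * T) < d\<close>.\<close>

lemma shift_private_noise_exists:
  assumes \<rho>: "0 < \<rho>" "\<rho> \<le> 1" and d: "0 < d"
  shows "\<exists>\<nu> (\<mu>::real). finite (set_pmf \<nu>) \<and> expect \<nu> real = \<mu> \<and> expect \<nu> (\<lambda>n. (real n - \<mu>)\<^sup>2) \<le> 8 / \<rho>\<^sup>2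
      \<and> shift_private \<rho> d \<nu>"
proof -
  define r where "r = exp (- \<rho>)"
  have r: "0 < r" "r < 1" "exp \<rho> * r = 1" using \<rho> by (auto simp: r_def exp_add[symmetric])
  obtain T where T: "r ^ T < d" using real_arch_pow_inv[OF d r(2)] by blast
  define w where "w j = r ^ (if j \<le> T then T - j else j - T)" for j
  define Z where "Z = (\<Sum>j\<le>2*T. w j)"
  have w0: "w j > 0" for j using r by (simp add: w_def)
  \<comment> \<open>The peak has weight 1, so \<open>Z \<ge> 1\<close> and normalization cannot
    enlarge the boundary mass.\<close>
  have "w T \<le> Z" unfolding Z_def using w0 by (intro member_le_sum) (auto intro: less_imp_le)
  then have Z: "Z \<ge> 1" by (simp add: w_def)
  define f where "f j = (if j \<le> 2 * T then w j / Z else 0)" for j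
  define \<nu> where "\<nu> = embed_pmf f"
  have pmf: "pmf \<nu> j = f j" for j
    unfolding \<nu>_def
  proof (rule pmf_embed_pmf)
    show "0 \<le> f x" for x using w0 Z by (auto simp: f_def intro: less_imp_le)
    have "(\<integral>\<^sup>+x. ennreal (f x) \<partial>count_space UNIV) = (\<Sum>x\<in>{..2*T}. ennreal (f x))"
      by (rule nn_integral_count_space') (auto simp: f_def)
    also have "\<dots> = ennreal (\<Sum>x\<in>{..2*T}. f x)"
      using \<open>\<And>x. 0 \<le> f x\<close> by (intro sum_ennreal) auto
    also have "(\<Sum>x\<in>{..2*T}. f x) = 1"
      using Z by (simp add: f_def Z_def sum_divide_distrib[symmetric])
    finally show "(\<integral>\<^sup>+x. ennreal (f x) \<partial>count_space UNIV) = 1" by simp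
  qed
  have set: "set_pmf \<nu> \<subseteq> {..2*T}" by (auto simp: set_pmf_eq pmf f_def split: if_splits)
  have E: "expect \<nu> g = (\<Sum>j\<le>2*T. w j * g j) / Z" for g
  proof -
    have "expect \<nu> g = (\<Sum>j\<le>2*T. pmf \<nu> j *\<^sub>R g j)"
      by (rule integral_measure_pmf) (use set in auto)
    also have "\<dots> = (\<Sum>j\<le>2*T. w j * g j / Z)" by (intro sum.cong) (auto simp: pmf f_def)
    finally show ?thesis by (simp add: sum_divide_distrib)
  qed
  have fin: "finite (set_pmf \<nu>)" using set finite_subset by blast
  have mean: "expect \<nu> real = T"
  proof -
    let ?A = "\<Sum>j\<le>2*T. w j * (real j - T)"
    have "?A = (\<Sum>j\<le>2*T. w (2 * T - j) * (real (2 * T - j) - T))"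
      by (rule sum.reindex_bij_witness[of _ "\<lambda>j. 2 * T - j" "\<lambda>j. 2 * T - j"]) auto
    also have "\<dots> = (\<Sum>j\<le>2*T. - (w j * (real j - T)))"
      by (intro sum.cong) (auto simp: w_def of_nat_diff algebra_simps)
    finally have "?A = 0" by (simp add: sum_negf)
    then have "(\<Sum>j\<le>2*T. w j * real j) = T * Z"
      by (simp add: Z_def sum_subtractf sum_distrib_left right_diff_distrib mult_ac)
    then show ?thesis using Z by (simp add: E)
  qed
  have "8 / \<rho>\<^sup>2 \<ge> expect \<nu> (\<lambda>n. (real n - T)\<^sup>2)"
  proof -
    have split: "(\<Sum>j\<le>2*T. w j * h j) = (\<Sum>i=1..T. r ^ i * h (T - i)) + (\<Sum>i=1..T. r ^ i * h (T + i)) + h T" for h :: "nat \<Rightarrow> real"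
    proof -
      have "{..2*T} = {..<T} \<union> {T<..2*T} \<union> {T}" by auto
      then have "(\<Sum>j\<le>2*T. w j * h j) = (\<Sum>j<T. w j * h j) + (\<Sum>j\<in>{T<..2*T}. w j * h j) + w T * h T"
        by (simp add: sum.union_disjoint[of "{..<T}" "{T<..2*T}"] disjoint_iff)
      moreover have "(\<Sum>j<T. w j * h j) = (\<Sum>i=1..T. r ^ i * h (T - i))"
        by (rule sum.reindex_bij_witness[of _ "\<lambda>i. T - i" "\<lambda>i. T - i"]) (auto simp: w_def)
      moreover have "(\<Sum>j\<in>{T<..2*T}. w j * h j) = (\<Sum>i=1..T. r ^ i * h (T + i))"
        by (rule sum.reindex_bij_witness[of _ "\<lambda>i. T + i" "\<lambda>i. i - T"]) (auto simp: w_def)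
      ultimately show ?thesis by (simp add: w_def)
    qed
    \<comment> \<open>Both sides are compared after multiplication by \<open>1 + \<rho>\<close>: on
      the left \<open>r * exp \<rho> = 1\<close> is used, on the right
      \<open>\<rho> \<le> 1\<close>.\<close>
    have "\<rho> / 2 \<le> 1 - r"
    proof -
      have "1 + \<rho> \<le> exp \<rho>" by (rule exp_ge_add_one_self)
      then have "r * (1 + \<rho>) \<le> r * exp \<rho>" using r by (intro mult_left_mono) auto
      also have "\<dots> = 1" using r by (simp add: mult.commute)
      finally have "r * (1 + \<rho>) \<le> 1" .
      moreover have "1 \<le> (1 - \<rho> / 2) * (1 + \<rho>)"
        using \<rho> mult_left_mono[of \<rho> 1 \<rho>] by (simp add: algebra_simps)
      ultimately have "r * (1 + \<rho>) \<le> (1 - \<rho> / 2) * (1 + \<rho>)" by linarith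
      then show ?thesis using \<rho> by (simp add: mult_le_cancel_right)
    qed
    then have "(\<rho> / 2)\<^sup>2 \<le> (1 - r)\<^sup>2" using \<rho> by (intro power_mono) auto
    let ?S2 = "\<Sum>i=1..T. (real i)\<^sup>2 * r ^ i" and ?S0 = "\<Sum>i=1..T. r ^ i"
    have "?S2 \<ge> 0" using r by (intro sum_nonneg) auto
    have "(\<Sum>j\<le>2*T. w j * (real j - T)\<^sup>2) = 2 * ?S2"
      unfolding split by (simp add: of_nat_diff mult_ac)
    moreover have "Z = 2 * ?S0 + 1" using split[of "\<lambda>_. 1"] by (simp add: Z_def)
    \<comment> \<open>Since \<open>2 * ?S0 \<le> Z\<close>, the variance \<open>2 * ?S2 / Z\<close>
      is at most \<open>8 / \<rho>^2\<close>.\<close>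
    moreover have "(\<rho> / 2)\<^sup>2 * ?S2 \<le> 2 * ?S0"
      using sum_geometric_squares_le[of r T] r mult_right_mono[OF \<open>(\<rho> / 2)\<^sup>2 \<le> (1 - r)\<^sup>2\<close> \<open>?S2 \<ge> 0\<close>] by linarith
    ultimately show ?thesis using \<rho> Z unfolding E by (simp add: field_simps power2_eq_square)
  qed
  moreover have "shift_private \<rho> d \<nu>"
    unfolding shift_private_def
  proof (intro allI impI conjI)
    fix g :: "nat \<Rightarrow> real" assume g: "\<forall>n. 0 \<le> g n \<and> g n \<le> 1"
    have step: "w j \<le> exp \<rho> * w (Suc j)" "w (Suc j) \<le> exp \<rho> * w j" for j
    proof -
      have a: "r ^ n \<le> exp \<rho> * r ^ Suc n" for n using r by (simp add: mult.assoc[symmetric])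
      have b: "r ^ Suc n \<le> exp \<rho> * r ^ n" for n
      proof -
        have "r ^ Suc n \<le> 1 * r ^ n" using r by simp
        also have "\<dots> \<le> exp \<rho> * r ^ n" using r \<rho> by (intro mult_right_mono) auto
        finally show ?thesis .
      qed
      have "w j = r ^ Suc (T - Suc j) \<and> w (Suc j) = r ^ (T - Suc j) \<or>
          w j = r ^ (j - T) \<and> w (Suc j) = r ^ Suc (j - T)"
        by (cases "Suc j \<le> T") (auto simp: w_def Suc_diff_Suc Suc_diff_le not_le simp del: power_Suc)
      then show "w j \<le> exp \<rho> * w (Suc j)" "w (Suc j) \<le> exp \<rho> * w j"
        by (elim disjE conjE; simp only: a b)+
    qed
    have dZ: "d / Z \<le> d" using Z d by (simp add: divide_le_eq mult_le_cancel_left1)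
    \<comment> \<open>A shift by one moves a single endpoint out of the support; its mass is the
      whole additive error.\<close>
    have end_le: "w (2 * T) \<le> d" "w 0 \<le> d" using T by (auto simp: w_def mult_2)
    have "(\<Sum>j\<le>2*T. w j * g (Suc j)) = (\<Sum>j<2*T. w j * g (Suc j)) + w (2*T) * g (Suc (2*T))"
      by (simp add: lessThan_Suc_atMost[symmetric])
    also have "\<dots> \<le> (\<Sum>j<2*T. exp \<rho> * w (Suc j) * g (Suc j)) + d * 1"
      using g step w0 end_le d by (intro add_mono sum_mono mult_right_mono mult_mono) (auto intro: less_imp_le)
    also have "(\<Sum>j<2*T. exp \<rho> * w (Suc j) * g (Suc j)) \<le> exp \<rho> * (\<Sum>j\<le>2*T. w j * g j)"
      using g w0 by (simp add: sum.atMost_shift sum_distrib_left[symmetric] mult.assoc less_imp_le)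
    finally have "(\<Sum>j\<le>2*T. w j * g (Suc j)) / Z \<le> (exp \<rho> * (\<Sum>j\<le>2*T. w j * g j) + d * 1) / Z"
      using Z by (intro divide_right_mono) auto
    also have "\<dots> \<le> exp \<rho> * ((\<Sum>j\<le>2*T. w j * g j) / Z) + d"
      using dZ by (simp add: add_divide_distrib)
    finally show "expect \<nu> (\<lambda>n. g (Suc n)) \<le> exp \<rho> * expect \<nu> g + d" unfolding E .
    have "(\<Sum>j\<le>2*T. w j * g j) = (\<Sum>j<2*T. w (Suc j) * g (Suc j)) + w 0 * g 0"
      by (simp add: sum.atMost_shift)
    also have "\<dots> \<le> (\<Sum>j<2*T. exp \<rho> * w j * g (Suc j)) + d * 1"
      using g step w0 end_le d by (intro add_mono sum_mono mult_right_mono mult_mono) (auto intro: less_imp_le)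
    also have "(\<Sum>j<2*T. exp \<rho> * w j * g (Suc j)) \<le> exp \<rho> * (\<Sum>j\<le>2*T. w j * g (Suc j))"
      using g w0 by (simp add: lessThan_Suc_atMost[symmetric] sum_distrib_left[symmetric] mult.assoc less_imp_le)
    finally have "(\<Sum>j\<le>2*T. w j * g j) / Z \<le> (exp \<rho> * (\<Sum>j\<le>2*T. w j * g (Suc j)) + d * 1) / Z"
      using Z by (intro divide_right_mono) auto
    also have "\<dots> \<le> exp \<rho> * ((\<Sum>j\<le>2*T. w j * g (Suc j)) / Z) + d"
      using dZ by (simp add: add_divide_distrib)
    finally show "expect \<nu> g \<le> exp \<rho> * expect \<nu> (\<lambda>n. g (Suc n)) + d" unfolding E .
  qed
  ultimately show ?thesis using fin mean by blast
qed

text \<open>Averaging \<open>\<Phi>\<close> over all cells but \<open>v\<close> leaves a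
  [0,1]-valued function of the noise in cell \<open>v\<close>, to which the one-dimensional property
  applies.\<close>

lemma shift_private_Pi_pmf:
  assumes \<nu>: "shift_private \<rho> d \<nu>" "finite (set_pmf \<nu>)" and A: "finite A" "v \<in> A"
    and \<Phi>: "\<And>f. 0 \<le> \<Phi> f" "\<And>f. \<Phi> f \<le> 1"
  defines "P \<equiv> Pi_pmf A 0 (\<lambda>_. \<nu>)"
  shows "expect P (\<lambda>f. \<Phi> (f(v := Suc (f v)))) \<le> exp \<rho> * expect P \<Phi> + d"
    and "expect P \<Phi> \<le> exp \<rho> * expect P (\<lambda>f. \<Phi> (f(v := Suc (f v)))) + d"
proof -
  define B where "B = A - {v}"
  have B: "A = insert v B" "v \<notin> B" "finite B" using A by (auto simp: B_def)
  define g where "g y = expect (Pi_pmf B 0 (\<lambda>_. \<nu>)) (\<lambda>f. \<Phi> (f(v := y)))" for y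
  have fin: "finite (set_pmf (Pi_pmf B 0 (\<lambda>_. \<nu>)))" using B \<nu> by (intro finite_set_Pi_pmf)
  have "g y \<le> expect (Pi_pmf B 0 (\<lambda>_. \<nu>)) (\<lambda>_. 1)" for y
    unfolding g_def using \<Phi> fin by (intro expect_mono)
  then have g: "\<forall>n. 0 \<le> g n \<and> g n \<le> 1" using \<Phi> by (auto simp: g_def)
  have 1: "expect P \<Phi> = expect \<nu> g" "expect P (\<lambda>f. \<Phi> (f(v := Suc (f v)))) = expect \<nu> (\<lambda>n. g (Suc n))"
    unfolding P_def B(1) g_def using B \<nu> by (simp_all add: expect_Pi_insert)
  show "expect P (\<lambda>f. \<Phi> (f(v := Suc (f v)))) \<le> exp \<rho> * expect P \<Phi> + d"
    and "expect P \<Phi> \<le> exp \<rho> * expect P (\<lambda>f. \<Phi> (f(v := Suc (f v)))) + d"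
    using \<nu>(1) g unfolding 1 shift_private_def by blast+
qed

section \<open>Privacy of the randomizers\<close>

definition noise_messages :: "nat \<Rightarrow> nat pmf \<Rightarrow> nat list pmf" where
  "noise_messages K \<nu> =
     map_pmf (\<lambda>f. concat (map (\<lambda>v. replicate (f v) v) [0..<K])) (Pi_pmf {..<K} 0 (\<lambda>_. \<nu>))"

text \<open>
  The message \<open>3 * x + c\<close> stands for the sample \<open>x\<close> reported to the histogram \<open>c < 3\<close>. User
  \<open>3 * m\<close> sends the noise for all histograms, and later users send nothing.
\<close>

definition user_randomizer :: "nat \<Rightarrow> nat \<Rightarrow> nat pmf \<Rightarrow> nat \<Rightarrow> nat randomizer" where
  "user_randomizer m K \<nu> i U x =
     (if i < 3 * m then map_pmf (\<lambda>b. if b then [3 * x + i mod 3] else []) (bernoulli_pmf (1/3))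
      else if i = 3 * m then noise_messages K \<nu> else return_pmf [])"

lemma finite_set_noise_messages: "finite (set_pmf \<nu>) \<Longrightarrow> finite (set_pmf (noise_messages K \<nu>))"
  by (simp add: noise_messages_def finite_set_Pi_pmf)

lemma finite_set_user_randomizer:
  "finite (set_pmf \<nu>) \<Longrightarrow> finite (set_pmf (user_randomizer m K \<nu> i U x))"
  by (simp add: user_randomizer_def finite_set_noise_messages)

lemma mset_concat_map_upt: "mset (concat (map Y [0..<n])) = (\<Sum>i<n. mset (Y i))"
  by (induction n) auto

lemma message_code_less: "a \<le> b \<Longrightarrow> c < 3 \<Longrightarrow> 3 * a + c < 3 * (b + 1)" for a b c :: nat
  by simp

text \<open>The output is a mixture: with probability 2/3 the changed user is silent, which looks
  the same for both datasets. With probability 1/3 it sends a message, and one message is compared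
  with the other through the silent case, each half costing \<open>\<epsilon> / 2\<close> and
  \<open>\<delta> / 3\<close>.\<close>

lemma shuffler_output_private:
  assumes \<nu>: "finite (set_pmf \<nu>)" and K: "K = 3 * (k + 1)" and n: "3 * m < n"
    and \<epsilon>: "0 < \<epsilon>" "\<epsilon> \<le> 1" and \<delta>: "0 < \<delta>"
    and ok: "1 / 3 \<le> \<delta> \<or> shift_private (\<epsilon> / 2) (\<delta> / 3) \<nu>"
  shows "differentially_private k n \<epsilon> \<delta> (shuffler_output n (user_randomizer m K \<nu>) U)"
  unfolding differentially_private_def
proof (intro allI impI)
  fix xs xs' :: "nat \<Rightarrow> nat" and S :: "nat list set"
  assume xs: "\<forall>i<n. xs i \<in> {1..k}" and xs': "\<forall>i<n. xs' i \<in> {1..k}" and "neighbouring n xs xs'"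
  then obtain j where j: "j < n" "\<And>i. i < n \<Longrightarrow> i \<noteq> j \<Longrightarrow> xs i = xs' i"
    unfolding neighbouring_def by blast
  let ?R = "user_randomizer m K \<nu>" and ?M = "\<lambda>xs. shuffler_output n (user_randomizer m K \<nu>) U xs"
  have e1: "1 \<le> exp \<epsilon>" using \<epsilon> by simp
  show "measure_pmf.prob (?M xs) S \<le> exp \<epsilon> * measure_pmf.prob (?M xs') S + \<delta>"
  proof (cases "j < 3 * m")
    case False
    have "?R i U (xs i) = ?R i U (xs' i)" if "i < n" for i
      using j that False by (cases "i = j") (auto simp: user_randomizer_def)
    then have "?M xs = ?M xs'"
      unfolding shuffler_output_def by (intro bind_pmf_cong Pi_pmf_cong) auto
    moreover have "1 * measure_pmf.prob (?M xs') S \<le> exp \<epsilon> * measure_pmf.prob (?M xs') S"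
      using e1 by (intro mult_right_mono) auto
    ultimately show ?thesis using \<delta> by simp
  next
    case True
    define B where "B = {..<n} - {j, 3 * m}"
    have B: "{..<n} = insert j (insert (3 * m) B)" "finite B" "j \<notin> insert (3 * m) B" "3 * m \<notin> B"
      using j True n by (auto simp: B_def)
    \<comment> \<open>The law of a shuffled list depends only on its multiset, so the choice of a
      representative list is immaterial.\<close>
    define shuf where "shuf M = measure_pmf.prob (shuffle_messages (SOME ms. mset ms = M)) S" for M
    have shuf: "measure_pmf.prob (shuffle_messages ms) S = shuf (mset ms)" for ms
      unfolding shuf_def by (rule arg_cong[of _ _ "\<lambda>p. measure_pmf.prob p S"], rule shuffle_messages_cong)
        (metis (mono_tags, lifting) someI)
    have shuf01: "0 \<le> shuf M" "shuf M \<le> 1" for M by (simp_all add: shuf_def)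
    let ?P = "Pi_pmf B [] (\<lambda>i. ?R i U (xs i))"
    have finP: "finite (set_pmf ?P)" by (intro finite_set_Pi_pmf B finite_set_user_randomizer \<nu>)
    \<comment> \<open>The users other than the changed one and the noise user have equal samples in
      both datasets; they are averaged out here.\<close>
    define \<Phi> where "\<Phi> M = expect ?P (\<lambda>Y. shuf (M + (\<Sum>i\<in>B. mset (Y i))))" for M
    have \<Phi>01: "0 \<le> \<Phi> M" "\<Phi> M \<le> 1" for M
    proof -
      show "0 \<le> \<Phi> M" unfolding \<Phi>_def using shuf01 by simp
      have "\<Phi> M \<le> expect ?P (\<lambda>_. 1)" unfolding \<Phi>_def using finP shuf01 by (intro expect_mono)
      then show "\<Phi> M \<le> 1" by simp
    qed
    let ?N = "Pi_pmf {..<K} 0 (\<lambda>_. \<nu>)"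
    have finN: "finite (set_pmf ?N)" by (intro finite_set_Pi_pmf \<nu>) auto
    define nm where "nm f = (\<Sum>v<K. replicate_mset (f v) v)" for f
    have nm: "nm (f(v := Suc (f v))) = add_mset v (nm f)" if "v < K" for f v
    proof -
      have "nm g = replicate_mset (g v) v + (\<Sum>u\<in>{..<K} - {v}. replicate_mset (g u) u)" for g
        unfolding nm_def by (rule sum.remove) (use that in auto)
      moreover have "(\<Sum>u\<in>{..<K} - {v}. replicate_mset ((f(v := Suc (f v))) u) u) = (\<Sum>u\<in>{..<K} - {v}. replicate_mset (f u) u)"
        by (intro sum.cong) auto
      ultimately show ?thesis by simp
    qed
    have noise: "expect (noise_messages K \<nu>) (\<lambda>ms. h (mset ms)) = expect ?N (\<lambda>f. h (nm f))" for h :: "nat multiset \<Rightarrow> real"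
      by (simp add: noise_messages_def mset_concat_map_upt nm_def)
    define G where "G v = expect ?N (\<lambda>f. \<Phi> (nm (f(v := Suc (f v)))))" for v
    define G0 where "G0 = expect ?N (\<lambda>f. \<Phi> (nm f))"
    have G0: "0 \<le> G0" unfolding G0_def using \<Phi>01 by simp
    have G01: "0 \<le> G v" "G v \<le> 1" for v
    proof -
      show "0 \<le> G v" unfolding G_def using \<Phi>01 by simp
      have "G v \<le> expect ?N (\<lambda>_. 1)" unfolding G_def using finN \<Phi>01 by (intro expect_mono)
      then show "G v \<le> 1" by simp
    qed
    have prob: "measure_pmf.prob (?M zs) S = 1 / 3 * G (3 * zs j + j mod 3) + 2 / 3 * G0"
      if zs: "\<And>i. i < n \<Longrightarrow> i \<noteq> j \<Longrightarrow> zs i = xs i" "zs j \<in> {1..k}" for zs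
    proof -
      have less: "3 * zs j + j mod 3 < K"
        unfolding K by (rule message_code_less) (use zs(2) in auto)
      have P: "Pi_pmf B [] (\<lambda>i. ?R i U (zs i)) = ?P"
        using zs(1) by (intro Pi_pmf_cong) (auto simp: B_def)
      have ms: "mset (concat (map (Y(3 * m := N, j := l)) [0..<n])) = mset l + mset N + (\<Sum>i\<in>B. mset (Y i))" for Y N l
      proof -
        have "(\<Sum>i\<in>B. mset ((Y(3 * m := N, j := l)) i)) = (\<Sum>i\<in>B. mset (Y i))"
          using B by (intro sum.cong) auto
        then show ?thesis using B True by (simp add: mset_concat_map_upt)
      qed
      have "measure_pmf.prob (?M zs) S
          = expect (Pi_pmf {..<n} [] (\<lambda>i. ?R i U (zs i))) (\<lambda>Y. shuf (mset (concat (map Y [0..<n]))))"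
        unfolding shuffler_output_def shuf[symmetric]
        by (intro prob_bind finite_set_Pi_pmf finite_set_user_randomizer finite_set_shuffle_messages \<nu>) auto
      also have "\<dots> = expect (?R j U (zs j)) (\<lambda>l. expect (?R (3 * m) U (zs (3 * m))) (\<lambda>N. \<Phi> (mset l + mset N)))"
      proof -
        have "expect (Pi_pmf {..<n} [] (\<lambda>i. ?R i U (zs i))) h
            = expect (?R j U (zs j)) (\<lambda>l. expect (Pi_pmf (insert (3 * m) B) [] (\<lambda>i. ?R i U (zs i))) (\<lambda>Y. h (Y(j := l))))" for h
          unfolding B(1) by (rule expect_Pi_insert) (use B finite_set_user_randomizer[OF \<nu>] in auto)
        moreover have "expect (Pi_pmf (insert (3 * m) B) [] (\<lambda>i. ?R i U (zs i))) h
            = expect (?R (3 * m) U (zs (3 * m))) (\<lambda>N. expect ?P (\<lambda>Y. h (Y(3 * m := N))))" for h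
          unfolding P[symmetric] by (rule expect_Pi_insert) (use B finite_set_user_randomizer[OF \<nu>] in auto)
        ultimately show ?thesis unfolding \<Phi>_def by (simp only: ms)
      qed
      also have "\<dots> = expect (?R j U (zs j)) (\<lambda>l. expect ?N (\<lambda>f. \<Phi> (mset l + nm f)))"
      proof -
        have "?R (3 * m) U (zs (3 * m)) = noise_messages K \<nu>" by (simp add: user_randomizer_def)
        then show ?thesis using noise[of "\<lambda>M. \<Phi> (mset l + M)" for l] by simp
      qed
      also have "\<dots> = 1 / 3 * expect ?N (\<lambda>f. \<Phi> (add_mset (3 * zs j + j mod 3) (nm f))) + 2 / 3 * G0"
        using True by (simp add: user_randomizer_def G0_def)
      finally show ?thesis unfolding G_def nm[OF less] .
    qed
    let ?v = "3 * xs j + j mod 3" and ?v' = "3 * xs' j + j mod 3"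
    have v: "?v < K" "?v' < K"
      unfolding K using xs xs' j by (auto intro!: message_code_less)
    \<comment> \<open>For \<open>\<delta> \<ge> 1/3\<close> the event of sending is itself covered
      by \<open>\<delta>\<close>, whatever the noise.\<close>
    have main: "1 / 3 * G ?v \<le> exp \<epsilon> * (1 / 3 * G ?v') + \<delta>"
    proof (cases "1 / 3 \<le> \<delta>")
      case True
      then show ?thesis using G01[of ?v] G01[of ?v'] by (simp add: add_increasing)
    next
      case False
      then have sp: "shift_private (\<epsilon> / 2) (\<delta> / 3) \<nu>" using ok by blast
      have 1: "G ?v \<le> exp (\<epsilon> / 2) * G0 + \<delta> / 3"
        unfolding G_def G0_def by (rule shift_private_Pi_pmf(1)[OF sp \<nu>]) (use v \<Phi>01 in auto)
      have 2: "G0 \<le> exp (\<epsilon> / 2) * G ?v' + \<delta> / 3"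
        unfolding G_def G0_def by (rule shift_private_Pi_pmf(2)[OF sp \<nu>, where \<Phi> = "\<lambda>f. \<Phi> (nm f)"]) (use v \<Phi>01 in auto)
      \<comment> \<open>The additive errors of the two halves compose to
        \<open>\<delta> / 3 + exp (\<epsilon> / 2) * (\<delta> / 3)\<close>, which is then at most
        \<open>\<delta>\<close>.\<close>
      have e2: "exp (\<epsilon> / 2) \<le> 2"
      proof -
        have "(exp (\<epsilon> / 2))\<^sup>2 = exp \<epsilon>" by (simp add: power2_eq_square flip: exp_add)
        also have "\<dots> \<le> exp 1" using \<epsilon> by simp
        also have "\<dots> \<le> 2\<^sup>2" using exp_le by simp
        finally show ?thesis by (rule power2_le_imp_le) simp
      qed
      have "exp (\<epsilon> / 2) * G0 \<le> exp (\<epsilon> / 2) * (exp (\<epsilon> / 2) * G ?v' + \<delta> / 3)"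
        using 2 by (intro mult_left_mono) auto
      also have "\<dots> = exp \<epsilon> * G ?v' + exp (\<epsilon> / 2) * (\<delta> / 3)"
        by (simp add: distrib_left mult.assoc[symmetric] flip: exp_add)
      also have "\<dots> \<le> exp \<epsilon> * G ?v' + 2 * (\<delta> / 3)"
        using e2 \<delta> by (intro add_left_mono mult_right_mono) auto
      finally have "G ?v \<le> exp \<epsilon> * G ?v' + \<delta>" using 1 by simp
      then show ?thesis using \<delta> by simp
    qed
    have p1: "measure_pmf.prob (?M xs) S = 1 / 3 * G ?v + 2 / 3 * G0"
      by (rule prob) (use xs j in auto)
    have p2: "measure_pmf.prob (?M xs') S = 1 / 3 * G ?v' + 2 / 3 * G0"
      by (rule prob) (use xs' j in auto)
    have "2 / 3 * G0 \<le> exp \<epsilon> * (2 / 3 * G0)" using mult_right_mono[OF e1, of "2 / 3 * G0"] G0 by simp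
    then show ?thesis unfolding p1 p2 distrib_left using main by linarith
  qed
qed

section \<open>Independent histograms\<close>

text \<open>Samples are positive, so \<open>0\<close> encodes that nothing was sent.\<close>

definition sent_sample :: "nat pmf \<Rightarrow> nat pmf" where
  "sent_sample p = bind_pmf p (\<lambda>x. map_pmf (\<lambda>b. if b then x else 0) (bernoulli_pmf (1/3)))"

definition group_space :: "nat \<Rightarrow> nat \<Rightarrow> nat pmf \<Rightarrow> nat pmf \<Rightarrow> ((nat \<Rightarrow> nat) \<times> (nat \<Rightarrow> nat)) pmf" where
  "group_space m K \<nu> p = pair_pmf (Pi_pmf {..<3*m} 0 (\<lambda>_. sent_sample p)) (Pi_pmf {..<K} 0 (\<lambda>_. \<nu>))"

definition histogram :: "nat \<Rightarrow> nat \<Rightarrow> nat \<Rightarrow> (nat \<Rightarrow> nat) \<times> (nat \<Rightarrow> nat) \<Rightarrow> nat \<Rightarrow> nat" where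
  "histogram k m c = (\<lambda>(s, f) x. if x \<in> {1..k} then card {i. i < 3 * m \<and> i mod 3 = c \<and> s i = x} + f (3 * x + c) else 0)"

text \<open>Like \<open>histogram\<close> it is 0 outside \<open>{1..k}\<close>, so that the two can
  be equal as functions.\<close>

definition message_count :: "nat \<Rightarrow> nat \<Rightarrow> nat list \<Rightarrow> nat \<Rightarrow> nat" where
  "message_count k c ms x = (if x \<in> {1..k} then count_list ms (3 * x + c) else 0)"

lemma count_list_concat_map_upt: "count_list (concat (map Y [0..<n])) v = (\<Sum>i<n. count_list (Y i) v)"
  by (induction n) auto

lemma count_list_replicate: "count_list (replicate n x) y = (if x = y then n else 0)"
  by (induction n) auto

lemma finite_set_sent_sample: "finite (set_pmf p) \<Longrightarrow> finite (set_pmf (sent_sample p))"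
  by (simp add: sent_sample_def)

text \<open>Replaces the messages by independent sent samples and independent noise: each sample is
  fused with its randomizer, users beyond the noise user contribute nothing, and counts ignore the
  shuffle. The three histograms are kept jointly, as a function of \<open>c\<close>, since their
  independence is a separate argument.\<close>

lemma group_law:
  assumes p: "p \<in> distributions_on k" and K: "K = 3 * (k + 1)" and n: "3 * m < n"
  shows "map_pmf (\<lambda>ms c. if c < 3 then message_count k c ms else (\<lambda>_. 0))
           (bind_pmf (iid_samples n p) (shuffler_output n (user_randomizer m K \<nu>) U))
       = map_pmf (\<lambda>\<omega> c. if c < 3 then histogram k m c \<omega> else (\<lambda>_. 0)) (group_space m K \<nu> p)"
proof -
  let ?R = "user_randomizer m K \<nu>" and ?r = "\<lambda>i. bind_pmf p (user_randomizer m K \<nu> i U)"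
  define cnt where "cnt h = (\<lambda>c. if c < 3 then (\<lambda>x. if x \<in> {1..k} then h (3 * x + c) else 0) else (\<lambda>_. 0))"
    for h :: "nat \<Rightarrow> nat"
  define code where "code i s = (if s = 0 then [] else [3 * s + i mod 3])" for i s :: nat
  have cnt_ms: "(\<lambda>ms c. if c < 3 then message_count k c ms else (\<lambda>_. 0)) = (\<lambda>ms. cnt (count_list ms))"
    by (auto simp: fun_eq_iff message_count_def cnt_def)
  have p0: "x \<noteq> 0" if "x \<in> set_pmf p" for x using p that by (auto simp: distributions_on_def)
  have r: "?r i = map_pmf (code i) (sent_sample p)" if "i < 3 * m" for i
  proof -
    have "?r i = bind_pmf p (\<lambda>x. map_pmf (\<lambda>b. code i (if b then x else 0)) (bernoulli_pmf (1/3)))"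
      using that p0 by (intro bind_pmf_cong refl) (auto simp: user_randomizer_def code_def intro!: map_pmf_cong)
    then show ?thesis by (simp add: sent_sample_def map_bind_pmf map_pmf_comp)
  qed
  have r3: "?r (3 * m) = noise_messages K \<nu>"
    by (simp add: user_randomizer_def[abs_def])
  have Pi: "Pi_pmf {..<n} [] ?r = map_pmf (\<lambda>(N, s) i. if i = 3 * m then N else if i < 3 * m then code i (s i) else [])
      (pair_pmf (noise_messages K \<nu>) (Pi_pmf {..<3*m} 0 (\<lambda>_. sent_sample p)))"
  proof -
    have "Pi_pmf {..<n} [] ?r = Pi_pmf {..<n} [] (\<lambda>i. if i \<le> 3 * m then ?r i else return_pmf [])"
      by (intro Pi_pmf_cong) (auto simp: user_randomizer_def[abs_def])
    also have "\<dots> = Pi_pmf {i \<in> {..<n}. i \<le> 3 * m} [] ?r" by (rule Pi_pmf_if_set) simp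
    also have "{i \<in> {..<n}. i \<le> 3 * m} = insert (3 * m) {..<3*m}" using n by auto
    also have "Pi_pmf \<dots> [] ?r = map_pmf (\<lambda>(N, Y). Y(3 * m := N)) (pair_pmf (noise_messages K \<nu>) (Pi_pmf {..<3*m} [] ?r))"
      by (subst Pi_pmf_insert) (auto simp: r3)
    also have "Pi_pmf {..<3*m} [] ?r = map_pmf (\<lambda>s i. if i < 3 * m then code i (s i) else []) (Pi_pmf {..<3*m} 0 (\<lambda>_. sent_sample p))"
    proof -
      have "Pi_pmf {..<3*m} [] ?r = Pi_pmf {..<3*m} [] (\<lambda>i. bind_pmf (sent_sample p) (\<lambda>s. return_pmf (code i s)))"
        by (intro Pi_pmf_cong) (auto simp: r map_pmf_def)
      also have "\<dots> = bind_pmf (Pi_pmf {..<3*m} 0 (\<lambda>_. sent_sample p)) (\<lambda>s. Pi_pmf {..<3*m} [] (\<lambda>i. return_pmf (code i (s i))))"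
        by (rule Pi_pmf_bind) simp
      finally show ?thesis by (simp add: map_pmf_def)
    qed
    also have "map_pmf (\<lambda>(N, Y). Y(3 * m := N)) (pair_pmf (noise_messages K \<nu>) \<dots>)
      = map_pmf (\<lambda>(N, s) i. if i = 3 * m then N else if i < 3 * m then code i (s i) else [])
      (pair_pmf (noise_messages K \<nu>) (Pi_pmf {..<3*m} 0 (\<lambda>_. sent_sample p)))"
      unfolding pair_map_pmf2 map_pmf_comp by (intro map_pmf_cong) (auto simp: fun_eq_iff)
    finally show ?thesis .
  qed
  have counts: "cnt (\<lambda>v. \<Sum>i<n. count_list (if i = 3 * m then concat (map (\<lambda>v. replicate (f v) v) [0..<K]) else if i < 3 * m then code i (s i) else []) v)
      = (\<lambda>c. if c < 3 then histogram k m c (s, f) else (\<lambda>_. 0))" for s f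
  proof -
    have "(\<Sum>i<n. count_list (if i = 3 * m then concat (map (\<lambda>v. replicate (f v) v) [0..<K]) else if i < 3 * m then code i (s i) else []) (3 * x + c))
        = card {i. i < 3 * m \<and> i mod 3 = c \<and> s i = x} + f (3 * x + c)" if c: "c < 3" and x: "x \<in> {1..k}" for c x
    proof -
      let ?N = "concat (map (\<lambda>v. replicate (f v) v) [0..<K])"
      let ?g = "\<lambda>i. count_list (if i = 3 * m then ?N else if i < 3 * m then code i (s i) else []) (3 * x + c)"
      have "3 * x + c < K" unfolding K by (rule message_code_less) (use c x in auto)
      then have N: "count_list ?N (3 * x + c) = f (3 * x + c)"
        unfolding count_list_concat_map_upt by (simp add: count_list_replicate)
      have code: "count_list (code i y) (3 * x + c) = (if i mod 3 = c \<and> y = x then 1 else 0)" for i y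
      proof -
        have "3 * y + i mod 3 = 3 * x + c \<longleftrightarrow> i mod 3 = c \<and> y = x" using c by presburger
        then show ?thesis using x by (auto simp: code_def)
      qed
      have "(\<Sum>i<n. ?g i) = (\<Sum>i<Suc (3 * m). ?g i)"
        by (rule sum.mono_neutral_right) (use n in auto)
      also have "\<dots> = (\<Sum>i<3*m. if i mod 3 = c \<and> s i = x then 1 else 0) + f (3 * x + c)"
        by (simp add: N code)
      also have "(\<Sum>i<3*m. if i mod 3 = c \<and> s i = x then 1 else 0 :: nat) = card {i. i < 3 * m \<and> i mod 3 = c \<and> s i = x}"
        by (simp flip: sum.inter_filter)
      finally show ?thesis .
    qed
    then show ?thesis by (auto simp: cnt_def histogram_def fun_eq_iff)
  qed
  have "map_pmf (\<lambda>ms. cnt (count_list ms)) (bind_pmf (iid_samples n p) (shuffler_output n ?R U))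
      = bind_pmf (iid_samples n p) (\<lambda>xs. bind_pmf (Pi_pmf {..<n} [] (\<lambda>i. ?R i U (xs i)))
          (\<lambda>Y. map_pmf cnt (map_pmf count_list (shuffle_messages (concat (map Y [0..<n]))))))"
    by (simp add: shuffler_output_def map_bind_pmf map_pmf_comp)
  also have "\<dots> = map_pmf (\<lambda>Y. cnt (count_list (concat (map Y [0..<n])))) (Pi_pmf {..<n} [] ?r)"
    unfolding map_count_shuffle_messages Pi_pmf_bind[OF finite_lessThan, where d' = 0] iid_samples_def
    by (simp add: map_bind_pmf map_pmf_def bind_assoc_pmf bind_return_pmf)
  also have "\<dots> = map_pmf (\<lambda>(N, s). cnt (\<lambda>v. \<Sum>i<n. count_list (if i = 3 * m then N else if i < 3 * m then code i (s i) else []) v))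
      (pair_pmf (noise_messages K \<nu>) (Pi_pmf {..<3*m} 0 (\<lambda>_. sent_sample p)))"
    unfolding Pi map_pmf_comp count_list_concat_map_upt[abs_def] by (intro map_pmf_cong) auto
  also have "\<dots> = map_pmf (\<lambda>(f, s) c. if c < 3 then histogram k m c (s, f) else (\<lambda>_. 0))
      (pair_pmf (Pi_pmf {..<K} 0 (\<lambda>_. \<nu>)) (Pi_pmf {..<3*m} 0 (\<lambda>_. sent_sample p)))"
    unfolding noise_messages_def pair_map_pmf1 map_pmf_comp
    by (intro map_pmf_cong) (auto simp: counts)
  also have "\<dots> = map_pmf (\<lambda>\<omega> c. if c < 3 then histogram k m c \<omega> else (\<lambda>_. 0)) (group_space m K \<nu> p)"
    unfolding group_space_def by (subst pair_commute_pmf) (auto simp: map_pmf_comp case_prod_unfold)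
  finally show ?thesis unfolding cnt_ms .
qed

text \<open>\<open>h\<close> reads only coordinates in \<open>P\<close> and \<open>h'\<close> only
  the others. After resampling by \<open>Pi_pmf_split\<close> they are functions of different
  independent copies. One predicate \<open>P\<close> serves the users and the noise cells
  alike.\<close>

lemma pair_Pi_independent:
  fixes \<Omega> :: "((nat \<Rightarrow> 'a) \<times> (nat \<Rightarrow> 'b)) pmf"
  assumes \<Omega>: "\<Omega> = pair_pmf (Pi_pmf A d p) (Pi_pmf B e q)" and fin: "finite A" "finite B"
    and h: "\<And>s s' f f'. h (\<lambda>i. if P i then s i else s' i, \<lambda>i. if P i then f i else f' i) = h (s, f)"
    and h': "\<And>s s' f f'. h' (\<lambda>i. if P i then s i else s' i, \<lambda>i. if P i then f i else f' i) = h' (s', f')"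
  shows "map_pmf (\<lambda>\<omega>. (h \<omega>, h' \<omega>)) \<Omega> = pair_pmf (map_pmf h \<Omega>) (map_pmf h' \<Omega>)"
proof -
  let ?mix = "\<lambda>(s, s') i. if P i then s i else s' i" and ?mix' = "\<lambda>(s, s') i. if P i then s i else s' i"
  let ?S = "Pi_pmf A d p" and ?F = "Pi_pmf B e q"
  have "\<Omega> = pair_pmf (map_pmf ?mix (pair_pmf ?S ?S)) (map_pmf ?mix' (pair_pmf ?F ?F))"
    unfolding \<Omega> Pi_pmf_split[OF fin(1), of d p P, symmetric] Pi_pmf_split[OF fin(2), of e q P, symmetric] ..
  also have "\<dots> = do {s \<leftarrow> ?S; s' \<leftarrow> ?S; f \<leftarrow> ?F; f' \<leftarrow> ?F; return_pmf (?mix (s, s'), ?mix' (f, f'))}"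
    by (simp add: pair_pmf_def map_pmf_def bind_assoc_pmf bind_return_pmf)
  also have "\<dots> = do {s \<leftarrow> ?S; f \<leftarrow> ?F; s' \<leftarrow> ?S; f' \<leftarrow> ?F; return_pmf (?mix (s, s'), ?mix' (f, f'))}"
    by (subst (2) bind_commute_pmf) simp
  finally have "map_pmf (\<lambda>\<omega>. (h \<omega>, h' \<omega>)) \<Omega>
      = do {s \<leftarrow> ?S; f \<leftarrow> ?F; s' \<leftarrow> ?S; f' \<leftarrow> ?F; return_pmf (h (s, f), h' (s', f'))}"
    by (simp add: map_bind_pmf h h')
  also have "\<dots> = pair_pmf (map_pmf h \<Omega>) (map_pmf h' \<Omega>)"
    unfolding \<Omega> by (simp add: pair_pmf_def map_pmf_def bind_assoc_pmf bind_return_pmf)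
  finally show ?thesis .
qed

lemma group_space_independent:
  fixes m k K \<nu> p
  defines "\<Omega> \<equiv> group_space m K \<nu> p"
  shows "map_pmf (\<lambda>\<omega>. (histogram k m 0 \<omega>, histogram k m 1 \<omega>, histogram k m 2 \<omega>)) \<Omega>
    = pair_pmf (map_pmf (histogram k m 0) \<Omega>) (pair_pmf (map_pmf (histogram k m 1) \<Omega>) (map_pmf (histogram k m 2) \<Omega>))"
proof -
  \<comment> \<open>The class of user \<open>i\<close> is \<open>i mod 3\<close> and the cell
    \<open>3 * x + c\<close> has residue \<open>c\<close>, so histogram \<open>c\<close> reads only
    coordinates of residue \<open>c\<close> on both sides.\<close>
  have mix: "histogram k m c (\<lambda>i. if P (i mod 3) then s i else s' i, \<lambda>i. if P (i mod 3) then f i else f' i)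
      = (if P c then histogram k m c (s, f) else histogram k m c (s', f'))" if "c < 3" for c P s s' f f'
  proof -
    have "{i. i < 3 * m \<and> i mod 3 = c \<and> (if P (i mod 3) then s i else s' i) = x}
        = (if P c then {i. i < 3 * m \<and> i mod 3 = c \<and> s i = x} else {i. i < 3 * m \<and> i mod 3 = c \<and> s' i = x})" for x
      by auto
    moreover have "(3 * x + c) mod 3 = c" for x using that by simp
    ultimately show ?thesis by (auto simp: histogram_def fun_eq_iff)
  qed
  have 1: "map_pmf (\<lambda>\<omega>. (histogram k m 0 \<omega>, (histogram k m 1 \<omega>, histogram k m 2 \<omega>))) \<Omega>
      = pair_pmf (map_pmf (histogram k m 0) \<Omega>) (map_pmf (\<lambda>\<omega>. (histogram k m 1 \<omega>, histogram k m 2 \<omega>)) \<Omega>)"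
    unfolding \<Omega>_def group_space_def
    by (rule pair_Pi_independent[where P = "\<lambda>i. i mod 3 = 0", OF refl])
       (simp_all add: mix[where P = "\<lambda>r. r = 0"])
  have 2: "map_pmf (\<lambda>\<omega>. (histogram k m 1 \<omega>, histogram k m 2 \<omega>)) \<Omega>
      = pair_pmf (map_pmf (histogram k m 1) \<Omega>) (map_pmf (histogram k m 2) \<Omega>)"
    unfolding \<Omega>_def group_space_def
    by (rule pair_Pi_independent[where P = "\<lambda>i. i mod 3 = 1", OF refl])
       (simp_all add: mix[where P = "\<lambda>r. r = 1"] del: One_nat_def)
  show ?thesis using 1 unfolding 2 .
qed

section \<open>Moments of the histograms\<close>

lemma finite_set_distribution: "p \<in> distributions_on k \<Longrightarrow> finite (set_pmf p)"
  unfolding distributions_on_def using finite_subset by blast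

lemma expect_distribution:
  assumes "p \<in> distributions_on k"
  shows "expect p h = (\<Sum>x\<in>{1..k}. pmf p x * h x)"
  using assms by (subst integral_measure_pmf[of "{1..k}"]) (auto simp: distributions_on_def)

lemma sum_distribution: "p \<in> distributions_on k \<Longrightarrow> (\<Sum>x\<in>{1..k}. pmf p x) = 1"
  using sum_pmf_eq_1[of "{1..k}" p] by (auto simp: distributions_on_def)

lemma expect_sent_sample:
  assumes p: "p \<in> distributions_on k" and h: "h 0 = 0"
  shows "expect (sent_sample p) h = (\<Sum>x\<in>{1..k}. pmf p x * h x) / 3"
proof -
  have "expect (sent_sample p) h = expect p (\<lambda>x. expect (bernoulli_pmf (1/3)) (\<lambda>b. h (if b then x else 0)))"
    unfolding sent_sample_def using finite_set_distribution[OF p] by (subst expect_bind) auto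
  also have "\<dots> = expect p (\<lambda>x. h x / 3)" using h by simp
  finally show ?thesis using expect_distribution[OF p, of h] by simp
qed

lemma card_residue_class: "c < 3 \<Longrightarrow> card {i. i < 3 * m \<and> i mod 3 = c} = m" for c m :: nat
proof -
  assume c: "c < 3"
  have "bij_betw (\<lambda>j. 3 * j + c) {..<m} {i. i < 3 * m \<and> i mod 3 = c}"
    by (rule bij_betwI[where g = "\<lambda>i. i div 3"]) (use c in auto)
  then show ?thesis using bij_betw_same_card by fastforce
qed

text \<open>\<open>\<mu>\<close> is the mean of the noise in a cell. \<open>M\<close> is the
  expected number of samples sent by one class, one third of its users, which makes the estimate
  unbiased.\<close>

definition frequency_estimate :: "real \<Rightarrow> real \<Rightarrow> (nat \<Rightarrow> nat) \<Rightarrow> nat \<Rightarrow> real" where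
  "frequency_estimate \<mu> M h x = (real (h x) - \<mu>) / M"

text \<open>A linear functional of the error is a centred sum over the users of class
  \<open>c\<close> plus an independent centred sum over their noise cells. For the positive part,
  the count is nonnegative with the exact mean, so only the noise adds a bias; the sampling error
  adds none.\<close>

lemma
  fixes m k c :: nat and \<mu> v :: real
  assumes p: "p \<in> distributions_on k" and K: "K = 3 * (k + 1)" and c: "c < 3" and m: "m > 0"
    and \<nu>: "finite (set_pmf \<nu>)" "expect \<nu> real = \<mu>" "expect \<nu> (\<lambda>n. (real n - \<mu>)\<^sup>2) \<le> v"
  defines "M \<equiv> real m / 3"
  defines "P \<equiv> map_pmf (\<lambda>\<omega>. frequency_estimate \<mu> M (histogram k m c \<omega>)) (group_space m K \<nu> p)"
  shows histogram_estimates: "estimates {1..k} P (pmf p) (\<lambda>x. pmf p x / M + v / M\<^sup>2)"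
    and histogram_positive_part: "x \<in> {1..k} \<Longrightarrow> expect P (\<lambda>e. max 0 (e x)) \<le> pmf p x + sqrt v / M"
proof -
  let ?S = "Pi_pmf {..<3*m} 0 (\<lambda>_. sent_sample p)" and ?F = "Pi_pmf {..<K} 0 (\<lambda>_. \<nu>)"
  define J where "J = {i. i < 3 * m \<and> i mod 3 = c}"
  have J: "J \<subseteq> {..<3*m}" "card J = m" "finite J"
    using card_residue_class[OF c, of m] by (auto simp: J_def)
  have M: "M > 0" using m by (simp add: M_def)
  have finS: "finite (set_pmf (sent_sample p))" by (rule finite_set_sent_sample[OF finite_set_distribution[OF p]])
  have fin: "finite (set_pmf ?S)" "finite (set_pmf ?F)"
    using finS \<nu> by (auto intro!: finite_set_Pi_pmf)
  have code: "3 * x + c < K" if "x \<in> {1..k}" for x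
    unfolding K by (rule message_code_less) (use that c in auto)
  define V where "V = (\<lambda>x. 3 * x + c) ` {1..k}"
  have V: "V \<subseteq> {..<K}" using code by (auto simp: V_def)
  have inj: "inj_on (\<lambda>x. 3 * x + c) {1..k}" by (auto simp: inj_on_def)
  have sumV: "(\<Sum>u\<in>V. h u) = (\<Sum>x\<in>{1..k}. h (3 * x + c))" for h :: "nat \<Rightarrow> real"
    unfolding V_def by (subst sum.reindex[OF inj]) simp
  have div3: "(3 * x + c) div 3 = x" for x using c by simp
  have cardJ: "real (card {i. i < 3 * m \<and> i mod 3 = c \<and> s i = x}) = (\<Sum>i\<in>J. if s i = x then 1 else 0)" for s x
  proof -
    have "{i. i < 3 * m \<and> i mod 3 = c \<and> s i = x} = {i \<in> J. s i = x}" by (auto simp: J_def)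
    then show ?thesis using J(3) by (simp flip: sum.inter_filter)
  qed
  have fe: "frequency_estimate \<mu> M (histogram k m c (s, f)) x
      = (\<Sum>i\<in>J. if s i = x then 1 else 0) / M + (real (f (3 * x + c)) - \<mu>) / M" if "x \<in> {1..k}" for s f x
    using that by (simp add: frequency_estimate_def histogram_def cardJ add_divide_distrib diff_divide_distrib)
  have Pe: "expect P H = expect ?S (\<lambda>s. expect ?F (\<lambda>f. H (frequency_estimate \<mu> M (histogram k m c (s, f)))))" for H
    unfolding P_def group_space_def using fin by (simp add: expect_pair)
  show "estimates {1..k} P (pmf p) (\<lambda>x. pmf p x / M + v / M\<^sup>2)"
  proof -
    {
    fix a :: "nat \<Rightarrow> real"
    \<comment> \<open>Extension by 0 gives a silent user, encoded by 0, the value 0.\<close>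
    define A where "A y = (if y \<in> {1..k} then a y else 0)" for y
    define E where "E = (\<Sum>x\<in>{1..k}. pmf p x * a x) / 3"
    define g where "g = (\<lambda>(i::nat) y. (A y - E) / M)"
    define h where "h = (\<lambda>u n. a (u div 3) * (real n - \<mu>) / M)"
    have EA: "expect (sent_sample p) A = E"
      using expect_sent_sample[OF p, of A] by (simp add: A_def E_def)
    have EA2: "expect (sent_sample p) (\<lambda>y. (A y)\<^sup>2) = (\<Sum>x\<in>{1..k}. pmf p x * (a x)\<^sup>2) / 3"
      using expect_sent_sample[OF p, of "\<lambda>y. (A y)\<^sup>2"] by (simp add: A_def)
    have g0: "expect (sent_sample p) (g i) = 0" for i
      unfolding g_def using finS EA by (simp add: expect_diff)
    have h0: "expect \<nu> (h u) = 0" for u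
      unfolding h_def using \<nu> by (simp add: expect_diff)
    have "(\<Sum>x\<in>{1..k}. a x * (frequency_estimate \<mu> M (histogram k m c (s, f)) x - pmf p x))
        = (\<Sum>i\<in>J. g i (s i)) + (\<Sum>u\<in>V. h u (f u))" for s f
    proof -
      have "(\<Sum>x\<in>{1..k}. a x * (frequency_estimate \<mu> M (histogram k m c (s, f)) x - pmf p x))
        = (\<Sum>x\<in>{1..k}. (\<Sum>i\<in>J. if s i = x then a x else 0) / M - a x * pmf p x + a x * (real (f (3 * x + c)) - \<mu>) / M)"
      proof (rule sum.cong[OF refl])
        fix x assume x: "x \<in> {1..k}"
        have "(\<Sum>i\<in>J. if s i = x then a x else 0) = a x * (\<Sum>i\<in>J. if s i = x then 1 else 0)"
          unfolding sum_distrib_left by (intro sum.cong) auto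
        then show "a x * (frequency_estimate \<mu> M (histogram k m c (s, f)) x - pmf p x)
            = (\<Sum>i\<in>J. if s i = x then a x else 0) / M - a x * pmf p x + a x * (real (f (3 * x + c)) - \<mu>) / M"
          unfolding fe[OF x] using M by (simp add: field_simps)
      qed
      also have "\<dots> = (\<Sum>x\<in>{1..k}. \<Sum>i\<in>J. if s i = x then a x else 0) / M - 3 * E + (\<Sum>u\<in>V. h u (f u))"
      proof -
        have "(\<Sum>u\<in>V. h u (f u)) = (\<Sum>x\<in>{1..k}. a x * (real (f (3 * x + c)) - \<mu>) / M)"
          unfolding sumV h_def div3 ..
        moreover have "3 * E = (\<Sum>x\<in>{1..k}. a x * pmf p x)" by (simp add: E_def mult.commute)
        ultimately show ?thesis by (simp add: sum.distrib sum_subtractf sum_divide_distrib)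
      qed
      also have "(\<Sum>x\<in>{1..k}. \<Sum>i\<in>J. if s i = x then a x else 0) = (\<Sum>i\<in>J. A (s i))"
        by (subst sum.swap) (simp add: A_def)
      \<comment> \<open>There are \<open>m = 3 * M\<close> users in the class, so
        \<open>3 * E\<close> splits into \<open>E / M\<close> for each of them.\<close>
      also have "(\<Sum>i\<in>J. A (s i)) / M - 3 * E = (\<Sum>i\<in>J. g i (s i))"
      proof -
        have "(\<Sum>i\<in>J. g i (s i)) = ((\<Sum>i\<in>J. A (s i)) - m * E) / M"
          using J by (simp add: g_def sum_subtractf flip: sum_divide_distrib)
        then show ?thesis using m by (simp add: M_def diff_divide_distrib)
      qed
      finally show ?thesis .
    qed
    note eq = this
    have mS: "expect ?S (\<lambda>s. \<Sum>i\<in>J. g i (s i)) = 0"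
    proof -
      have "expect ?S (\<lambda>s. g i (s i)) = 0" if "i \<in> J" for i
        using expect_Pi_component[of "{..<3*m}" i 0 "\<lambda>_. sent_sample p" "g i"] J that g0 by auto
      then show ?thesis using fin by (simp add: expect_sum)
    qed
    have mF: "expect ?F (\<lambda>f. \<Sum>u\<in>V. h u (f u)) = 0"
    proof -
      have "expect ?F (\<lambda>f. h u (f u)) = 0" if "u \<in> V" for u
        using expect_Pi_component[of "{..<K}" u 0 "\<lambda>_. \<nu>" "h u"] V that h0 by auto
      then show ?thesis using fin by (simp add: expect_sum)
    qed
    have vS: "expect ?S (\<lambda>s. (\<Sum>i\<in>J. g i (s i))\<^sup>2) \<le> (\<Sum>x\<in>{1..k}. (a x)\<^sup>2 * (pmf p x / M))"
    proof -
      have "expect ?S (\<lambda>s. (\<Sum>i\<in>J. g i (s i))\<^sup>2) = (\<Sum>i\<in>J. expect (sent_sample p) (\<lambda>y. (g i y)\<^sup>2))"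
        by (rule expect_centred_sum_square) (use J finS g0 in auto)
      \<comment> \<open>Dropping \<open>- E^2\<close>, the source of the negative correlation
        between cells, leaves a diagonal bound.\<close>
      also have "\<dots> \<le> (\<Sum>i\<in>J. expect (sent_sample p) (\<lambda>y. (A y)\<^sup>2) / M\<^sup>2)"
      proof (rule sum_mono)
        fix i
        have "(\<lambda>y. (g i y)\<^sup>2) = (\<lambda>y. ((A y)\<^sup>2 - 2 * E * A y + E\<^sup>2) / M\<^sup>2)"
          by (auto simp: g_def power2_eq_square field_simps)
        then have "expect (sent_sample p) (\<lambda>y. (g i y)\<^sup>2) = (expect (sent_sample p) (\<lambda>y. (A y)\<^sup>2) - E\<^sup>2) / M\<^sup>2"
          using finS EA by (simp add: expect_add expect_diff power2_eq_square)
        also have "\<dots> \<le> expect (sent_sample p) (\<lambda>y. (A y)\<^sup>2) / M\<^sup>2" by (intro divide_right_mono) auto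
        finally show "expect (sent_sample p) (\<lambda>y. (g i y)\<^sup>2) \<le> expect (sent_sample p) (\<lambda>y. (A y)\<^sup>2) / M\<^sup>2" .
      qed
      also have "\<dots> = (\<Sum>x\<in>{1..k}. pmf p x * (a x)\<^sup>2) / M"
        using m J unfolding EA2 by (simp add: M_def power2_eq_square)
      finally show ?thesis by (simp add: sum_divide_distrib mult.commute)
    qed
    have vF: "expect ?F (\<lambda>f. (\<Sum>u\<in>V. h u (f u))\<^sup>2) \<le> (\<Sum>x\<in>{1..k}. (a x)\<^sup>2 * (v / M\<^sup>2))"
    proof -
      have "expect ?F (\<lambda>f. (\<Sum>u\<in>V. h u (f u))\<^sup>2) = (\<Sum>u\<in>V. expect \<nu> (\<lambda>y. (h u y)\<^sup>2))"
        by (rule expect_centred_sum_square) (use V \<nu> h0 in auto)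
      also have "\<dots> = (\<Sum>x\<in>{1..k}. (a x)\<^sup>2 / M\<^sup>2 * expect \<nu> (\<lambda>n. (real n - \<mu>)\<^sup>2))"
        unfolding sumV by (simp add: h_def div3 power_mult_distrib power_divide)
      also have "\<dots> \<le> (\<Sum>x\<in>{1..k}. (a x)\<^sup>2 / M\<^sup>2 * v)"
        using \<nu> by (intro sum_mono mult_left_mono) auto
      finally show ?thesis by simp
    qed
    have "expect P (\<lambda>e. \<Sum>x\<in>{1..k}. a x * (e x - pmf p x)) = 0"
      unfolding Pe eq using fin mS mF by (simp add: expect_add)
    moreover have "expect P (\<lambda>e. (\<Sum>x\<in>{1..k}. a x * (e x - pmf p x))\<^sup>2) \<le> (\<Sum>x\<in>{1..k}. (a x)\<^sup>2 * (pmf p x / M + v / M\<^sup>2))"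
    proof -
      have "expect P (\<lambda>e. (\<Sum>x\<in>{1..k}. a x * (e x - pmf p x))\<^sup>2)
          = expect (pair_pmf ?S ?F) (\<lambda>(s, f). ((\<Sum>i\<in>J. g i (s i)) + (\<Sum>u\<in>V. h u (f u)))\<^sup>2)"
        unfolding Pe eq using fin by (simp add: expect_pair)
      also have "\<dots> = expect ?S (\<lambda>s. (\<Sum>i\<in>J. g i (s i))\<^sup>2) + expect ?F (\<lambda>f. (\<Sum>u\<in>V. h u (f u))\<^sup>2)"
        by (rule expect_pair_sum_square[OF fin mS mF])
      finally show ?thesis using vS vF by (simp add: sum.distrib distrib_left)
    qed
    ultimately have "expect P (\<lambda>e. \<Sum>x\<in>{1..k}. a x * (e x - pmf p x)) = 0 \<and>
      expect P (\<lambda>e. (\<Sum>x\<in>{1..k}. a x * (e x - pmf p x))\<^sup>2) \<le> (\<Sum>x\<in>{1..k}. (a x)\<^sup>2 * (pmf p x / M + v / M\<^sup>2))" ..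
    }
    moreover have "finite (set_pmf P)" unfolding P_def group_space_def using fin by simp
    ultimately show ?thesis unfolding estimates_def by blast
  qed
  show "expect P (\<lambda>e. max 0 (e x)) \<le> pmf p x + sqrt v / M" if x: "x \<in> {1..k}"
  proof -
    let ?B = "\<lambda>s. (\<Sum>i\<in>J. if s i = x then 1 else 0) / M" and ?Z = "\<lambda>f. \<bar>real (f (3 * x + c)) - \<mu>\<bar> / M"
    \<comment> \<open>The positive part of a nonnegative count plus noise is at most the count plus
      the absolute noise.\<close>
    have le: "max 0 (frequency_estimate \<mu> M (histogram k m c (s, f)) x) \<le> ?B s + ?Z f" for s f
    proof -
      have "frequency_estimate \<mu> M (histogram k m c (s, f)) x = ?B s + (real (f (3 * x + c)) - \<mu>) / M"
        by (rule fe[OF x])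
      also have "\<dots> \<le> ?B s + ?Z f" using M by (intro add_left_mono divide_right_mono) auto
      finally show ?thesis using M by (auto intro!: add_nonneg_nonneg divide_nonneg_pos sum_nonneg)
    qed
    have "expect P (\<lambda>e. max 0 (e x)) \<le> expect ?S ?B + expect ?F ?Z"
    proof -
      have "expect P (\<lambda>e. max 0 (e x)) = expect (pair_pmf ?S ?F) (\<lambda>(s, f). max 0 (frequency_estimate \<mu> M (histogram k m c (s, f)) x))"
        unfolding Pe using fin by (simp add: expect_pair)
      also have "\<dots> \<le> expect (pair_pmf ?S ?F) (\<lambda>(s, f). ?B s + ?Z f)"
        using fin le by (intro expect_mono) auto
      finally show ?thesis using fin by (simp add: expect_pair expect_add)
    qed
    also have "expect ?S ?B = pmf p x"
    proof -
      have "expect ?S (\<lambda>s. if s i = x then 1 else 0) = pmf p x / 3" if "i \<in> J" for i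
      proof -
        have "expect ?S (\<lambda>s. if s i = x then 1 else 0) = expect (sent_sample p) (\<lambda>y. if y = x then 1 else 0)"
          by (rule expect_Pi_component[of "{..<3*m}" i 0 "\<lambda>_. sent_sample p" "\<lambda>y. if y = x then 1 else 0"]) (use J that in auto)
        also have "\<dots> = (\<Sum>y\<in>{1..k}. pmf p y * (if y = x then 1 else 0)) / 3"
          by (rule expect_sent_sample[OF p]) (use x in auto)
        also have "(\<Sum>y\<in>{1..k}. pmf p y * (if y = x then 1 else 0)) = pmf p x"
          using x by (simp add: mult_delta_right if_distrib cong: if_cong)
        finally show ?thesis .
      qed
      then have "(\<Sum>i\<in>J. expect ?S (\<lambda>s. if s i = x then 1 else 0)) = (\<Sum>i\<in>J. pmf p x / 3)"
        by (rule sum.cong[OF refl])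
      then show ?thesis using fin J m by (simp add: expect_sum M_def)
    qed
    also have "expect ?F ?Z \<le> sqrt v / M"
    proof -
      have "expect ?F ?Z = expect \<nu> (\<lambda>n. \<bar>real n - \<mu>\<bar>) / M"
        using expect_Pi_component[of "{..<K}" "3 * x + c" 0 "\<lambda>_. \<nu>" "\<lambda>n. \<bar>real n - \<mu>\<bar> / M"] code[OF x] by simp
      also have "expect \<nu> (\<lambda>n. \<bar>real n - \<mu>\<bar>) \<le> sqrt (expect \<nu> (\<lambda>n. (real n - \<mu>)\<^sup>2))"
        by (rule expect_abs_le_sqrt[OF \<nu>(1)])
      also have "\<dots> \<le> sqrt v" using \<nu>(3) by simp
      finally show ?thesis using M by (simp add: divide_right_mono)
    qed
    finally show ?thesis by simp
  qed
qed

section \<open>The closeness protocol\<close>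

lemma group_messages:
  fixes \<nu> :: "nat pmf"
  assumes p: "p \<in> distributions_on k" and K: "K = 3 * (k + 1)" and n: "3 * m < n"
  defines "X \<equiv> \<lambda>c. map_pmf (histogram k m c) (group_space m K \<nu> p)"
  shows "map_pmf (\<lambda>ms. (message_count k 0 ms, message_count k 1 ms, message_count k 2 ms))
           (bind_pmf (iid_samples n p) (shuffler_output n (user_randomizer m K \<nu>) U))
       = pair_pmf (X 0) (pair_pmf (X 1) (X 2))"
  using arg_cong[OF group_law[OF p K n, of \<nu> U], of "map_pmf (\<lambda>T. (T 0, T 1, T 2))"]
    group_space_independent[of k m K \<nu> p]
  by (simp add: map_pmf_comp X_def)

definition closeness_decision ::
    "nat \<Rightarrow> real \<Rightarrow> real \<Rightarrow> real \<Rightarrow> real \<Rightarrow> real \<Rightarrow> real \<Rightarrow> nat list \<Rightarrow> nat list \<Rightarrow> bool" where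
  "closeness_decision k l t \<mu>1 M1 \<mu>2 M2 ms1 ms2 \<longleftrightarrow>
     (let e1 = (\<lambda>c. frequency_estimate \<mu>1 M1 (message_count k c ms1));
          e2 = (\<lambda>c. frequency_estimate \<mu>2 M2 (message_count k c ms2))
      in statistic {1..k} l (e2 2) (\<lambda>x. e1 0 x - e2 0 x) (\<lambda>x. e1 1 x - e2 1 x) \<le> t)"

text \<open>Brings the run of the protocol into the form \<open>tester_error\<close> speaks about:
  weights and two differences, all independent. The two groups are independent by construction, the
  histograms inside a group by \<open>group_messages\<close>.\<close>

lemma decision_law:
  fixes \<nu>1 \<nu>2 :: "nat pmf" and \<mu>1 \<mu>2 M1 M2 l t :: real
  assumes p: "p \<in> distributions_on k" and q: "q \<in> distributions_on k" and K: "K = 3 * (k + 1)"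
    and n: "3 * m1 < n1" "3 * m2 < n2"
  defines "E1 \<equiv> \<lambda>c. map_pmf (\<lambda>\<omega>. frequency_estimate \<mu>1 M1 (histogram k m1 c \<omega>)) (group_space m1 K \<nu>1 p)"
    and "E2 \<equiv> \<lambda>c. map_pmf (\<lambda>\<omega>. frequency_estimate \<mu>2 M2 (histogram k m2 c \<omega>)) (group_space m2 K \<nu>2 q)"
  defines "A \<equiv> \<lambda>c. map_pmf (\<lambda>(e, f) x. e x - f x) (pair_pmf (E1 c) (E2 c))"
  shows "do {ms1 \<leftarrow> bind_pmf (iid_samples n1 p) (shuffler_output n1 (user_randomizer m1 K \<nu>1) U);
      ms2 \<leftarrow> bind_pmf (iid_samples n2 q) (shuffler_output n2 (user_randomizer m2 K \<nu>2) U);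
      return_pmf (closeness_decision k l t \<mu>1 M1 \<mu>2 M2 ms1 ms2)}
    = map_pmf (\<lambda>(e, a, a'). statistic {1..k} l e a a' \<le> t) (pair_pmf (E2 2) (pair_pmf (A 0) (A 1)))"
proof -
  let ?G1 = "bind_pmf (iid_samples n1 p) (shuffler_output n1 (user_randomizer m1 K \<nu>1) U)"
  let ?G2 = "bind_pmf (iid_samples n2 q) (shuffler_output n2 (user_randomizer m2 K \<nu>2) U)"
  let ?T = "\<lambda>ms. (message_count k 0 ms, message_count k 1 ms, message_count k 2 ms)"
  let ?f1 = "frequency_estimate \<mu>1 M1" and ?f2 = "frequency_estimate \<mu>2 M2"
  define X where "X = (\<lambda>c. map_pmf (histogram k m1 c) (group_space m1 K \<nu>1 p))"
  define Y where "Y = (\<lambda>c. map_pmf (histogram k m2 c) (group_space m2 K \<nu>2 q))"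
  define D where "D x0 x1 y0 y1 y2 = (statistic {1..k} l (?f2 y2) (\<lambda>x. ?f1 x0 x - ?f2 y0 x) (\<lambda>x. ?f1 x1 x - ?f2 y1 x) \<le> t)"
    for x0 x1 y0 y1 y2
  have E: "E1 c = map_pmf ?f1 (X c)" "E2 c = map_pmf ?f2 (Y c)" for c
    by (simp_all add: E1_def E2_def X_def Y_def map_pmf_comp)
  have "do {ms1 \<leftarrow> ?G1; ms2 \<leftarrow> ?G2; return_pmf (closeness_decision k l t \<mu>1 M1 \<mu>2 M2 ms1 ms2)}
      = do {(x0, x1, x2) \<leftarrow> map_pmf ?T ?G1; (y0, y1, y2) \<leftarrow> map_pmf ?T ?G2; return_pmf (D x0 x1 y0 y1 y2)}"
    by (simp add: bind_map_pmf closeness_decision_def D_def Let_def)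
  also have "\<dots> = do {(x0, x1, x2) \<leftarrow> pair_pmf (X 0) (pair_pmf (X 1) (X 2));
      (y0, y1, y2) \<leftarrow> pair_pmf (Y 0) (pair_pmf (Y 1) (Y 2)); return_pmf (D x0 x1 y0 y1 y2)}"
    unfolding X_def Y_def group_messages[OF p K n(1)] group_messages[OF q K n(2)] ..
  also have "\<dots> = do {(y0, y1, y2) \<leftarrow> pair_pmf (Y 0) (pair_pmf (Y 1) (Y 2));
      (x0, x1, x2) \<leftarrow> pair_pmf (X 0) (pair_pmf (X 1) (X 2)); return_pmf (D x0 x1 y0 y1 y2)}"
    unfolding case_prod_beta' by (rule bind_commute_pmf)
  \<comment> \<open>The third histogram of the first group does not enter the decision and is
    integrated out. The remaining steps only reorder the draws to \<open>y2\<close>, then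
    \<open>x0, y0\<close>, then \<open>x1, y1\<close>.\<close>
  also have "\<dots> = do {y0 \<leftarrow> Y 0; y1 \<leftarrow> Y 1; y2 \<leftarrow> Y 2; x0 \<leftarrow> X 0; x1 \<leftarrow> X 1; return_pmf (D x0 x1 y0 y1 y2)}"
    by (simp add: pair_pmf_def bind_assoc_pmf bind_return_pmf)
  also have "\<dots> = do {y0 \<leftarrow> Y 0; y2 \<leftarrow> Y 2; y1 \<leftarrow> Y 1; x0 \<leftarrow> X 0; x1 \<leftarrow> X 1; return_pmf (D x0 x1 y0 y1 y2)}"
    by (rule bind_pmf_cong[OF refl], rule bind_commute_pmf)
  also have "\<dots> = do {y2 \<leftarrow> Y 2; y0 \<leftarrow> Y 0; y1 \<leftarrow> Y 1; x0 \<leftarrow> X 0; x1 \<leftarrow> X 1; return_pmf (D x0 x1 y0 y1 y2)}"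
    by (rule bind_commute_pmf)
  also have "\<dots> = do {y2 \<leftarrow> Y 2; y0 \<leftarrow> Y 0; x0 \<leftarrow> X 0; y1 \<leftarrow> Y 1; x1 \<leftarrow> X 1; return_pmf (D x0 x1 y0 y1 y2)}"
    by (rule bind_pmf_cong[OF refl], rule bind_pmf_cong[OF refl], rule bind_commute_pmf)
  also have "\<dots> = do {y2 \<leftarrow> Y 2; x0 \<leftarrow> X 0; y0 \<leftarrow> Y 0; y1 \<leftarrow> Y 1; x1 \<leftarrow> X 1; return_pmf (D x0 x1 y0 y1 y2)}"
    by (rule bind_pmf_cong[OF refl], rule bind_commute_pmf)
  also have "\<dots> = do {y2 \<leftarrow> Y 2; x0 \<leftarrow> X 0; y0 \<leftarrow> Y 0; x1 \<leftarrow> X 1; y1 \<leftarrow> Y 1; return_pmf (D x0 x1 y0 y1 y2)}"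
    by (rule bind_pmf_cong[OF refl], rule bind_pmf_cong[OF refl], rule bind_pmf_cong[OF refl], rule bind_commute_pmf)
  also have "\<dots> = map_pmf (\<lambda>(e, a, a'). statistic {1..k} l e a a' \<le> t) (pair_pmf (E2 2) (pair_pmf (A 0) (A 1)))"
    unfolding A_def E D_def
    by (simp add: pair_pmf_def map_pmf_def bind_assoc_pmf bind_return_pmf)
  finally show ?thesis .
qed

definition closeness_protocol ::
    "nat \<Rightarrow> real \<Rightarrow> real \<Rightarrow> nat \<Rightarrow> nat \<Rightarrow> nat \<Rightarrow> nat \<Rightarrow> nat pmf \<Rightarrow> nat pmf \<Rightarrow> real \<Rightarrow> real \<Rightarrow> nat shuffle_protocol" where
  "closeness_protocol k l t n1 n2 m1 m2 \<nu>1 \<nu>2 \<mu>1 \<mu>2 =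
     \<lparr>public_bits = 0, users1 = n1, users2 = n2,
      randomizers1 = user_randomizer m1 (3 * (k + 1)) \<nu>1,
      randomizers2 = user_randomizer m2 (3 * (k + 1)) \<nu>2,
      analyzer = (\<lambda>U ms1 ms2. return_pmf (closeness_decision k l t \<mu>1 (m1 / 3) \<mu>2 (m2 / 3) ms1 ms2))\<rparr>"

lemma public_strings_closeness_protocol:
  "public_strings (closeness_protocol k l t n1 n2 m1 m2 \<nu>1 \<nu>2 \<mu>1 \<mu>2) = {[]}"
  by (auto simp: public_strings_def closeness_protocol_def)

lemma run_closeness_protocol:
  "run_protocol (closeness_protocol k l t n1 n2 m1 m2 \<nu>1 \<nu>2 \<mu>1 \<mu>2) p q
    = do {ms1 \<leftarrow> bind_pmf (iid_samples n1 p) (shuffler_output n1 (user_randomizer m1 (3 * (k + 1)) \<nu>1) []);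
      ms2 \<leftarrow> bind_pmf (iid_samples n2 q) (shuffler_output n2 (user_randomizer m2 (3 * (k + 1)) \<nu>2) []);
      return_pmf (closeness_decision k l t \<mu>1 (m1 / 3) \<mu>2 (m2 / 3) ms1 ms2)}"
proof -
  let ?S1 = "shuffler_output n1 (user_randomizer m1 (3 * (k + 1)) \<nu>1) []"
  let ?S2 = "shuffler_output n2 (user_randomizer m2 (3 * (k + 1)) \<nu>2) []"
  let ?D = "closeness_decision k l t \<mu>1 (m1 / 3) \<mu>2 (m2 / 3)"
  have "run_protocol (closeness_protocol k l t n1 n2 m1 m2 \<nu>1 \<nu>2 \<mu>1 \<mu>2) p q
    = do {xs \<leftarrow> iid_samples n1 p; ys \<leftarrow> iid_samples n2 q; ms1 \<leftarrow> ?S1 xs; ms2 \<leftarrow> ?S2 ys; return_pmf (?D ms1 ms2)}"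
    unfolding run_protocol_def public_strings_closeness_protocol
    by (simp add: pmf_of_set_singleton bind_return_pmf closeness_protocol_def)
  also have "\<dots> = do {xs \<leftarrow> iid_samples n1 p; ms1 \<leftarrow> ?S1 xs; ys \<leftarrow> iid_samples n2 q; ms2 \<leftarrow> ?S2 ys; return_pmf (?D ms1 ms2)}"
    by (rule bind_pmf_cong[OF refl], rule bind_commute_pmf)
  finally show ?thesis by (simp add: bind_assoc_pmf)
qed

lemma pmf_map_bool_ge:
  assumes "measure_pmf.prob \<Omega> {x. P x = b} \<le> 1 / 3"
  shows "2 / 3 \<le> pmf (map_pmf P \<Omega>) (\<not> b)"
proof -
  have "pmf (map_pmf P \<Omega>) (\<not> b) = measure_pmf.prob \<Omega> (UNIV - {x. P x = b})"
    unfolding pmf_map by (rule arg_cong[of _ _ "measure_pmf.prob \<Omega>"]) auto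
  also have "\<dots> = 1 - measure_pmf.prob \<Omega> {x. P x = b}"
    using measure_pmf.prob_compl[of "{x. P x = b}" \<Omega>] by simp
  finally show ?thesis using assms by simp
qed

text \<open>Instantiates the abstract test with \<open>m = M1\<close> for the differences and
  \<open>M = M2\<close> for the weights. The lower bounds on \<open>l\<close> are those that
  \<open>expect_weights\<close> asks for: \<open>k * l \<ge> 1\<close> and \<open>l\<close> at least
  the noise level of the second group.\<close>

lemma closeness_protocol_tests:
  fixes k m1 m2 :: nat and \<mu>1 \<mu>2 v1 v2 M1 M2 l t s \<alpha> :: real
  assumes k: "k \<ge> 1" and \<alpha>: "\<alpha> > 0" and m: "0 < m1" "m1 \<le> m2" and n: "3 * m1 < n1" "3 * m2 < n2"
    and \<nu>1: "finite (set_pmf \<nu>1)" "expect \<nu>1 real = \<mu>1" "expect \<nu>1 (\<lambda>n. (real n - \<mu>1)\<^sup>2) \<le> v1" "0 \<le> v1"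
    and \<nu>2: "finite (set_pmf \<nu>2)" "expect \<nu>2 real = \<mu>2" "expect \<nu>2 (\<lambda>n. (real n - \<mu>2)\<^sup>2) \<le> v2" "0 \<le> v2"
    and M: "M1 = real m1 / 3" "M2 = real m2 / 3"
    and l: "1 / k \<le> l" "sqrt v2 / M2 \<le> l"
    and t: "t = \<alpha>\<^sup>2 / (30 * (k * l))" and s: "s = v1 / M1\<^sup>2 + v2 / M2\<^sup>2"
    and J1: "240 * (4 * k + 2 / (M2 * l\<^sup>2)) / M1\<^sup>2 \<le> t\<^sup>2 / 2500"
    and J2: "3 / (l * M1\<^sup>2) \<le> t / 2500"
    and J3: "3 * k * s\<^sup>2 / l\<^sup>2 \<le> t\<^sup>2 / 2500"
  shows "tests_closeness k \<alpha> (closeness_protocol k l t n1 n2 m1 m2 \<nu>1 \<nu>2 \<mu>1 \<mu>2)"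
  unfolding tests_closeness_def
proof (intro ballI)
  fix p q assume p: "p \<in> distributions_on k" and q: "q \<in> distributions_on k"
  let ?I = "{1..k}" and ?K = "3 * (k + 1)"
  have Mpos: "M1 > 0" "M2 > 0" "M1 \<le> M2" using m M by auto
  have "0 < 1 / real k" using k by simp
  then have lpos: "l > 0" using l(1) by linarith
  have kl: "card ?I * l \<ge> 1" using l(1) k by (simp add: field_simps)
  define E1 where "E1 = (\<lambda>c. map_pmf (\<lambda>\<omega>. frequency_estimate \<mu>1 M1 (histogram k m1 c \<omega>)) (group_space m1 ?K \<nu>1 p))"
  define E2 where "E2 = (\<lambda>c. map_pmf (\<lambda>\<omega>. frequency_estimate \<mu>2 M2 (histogram k m2 c \<omega>)) (group_space m2 ?K \<nu>2 q))"
  define A where "A = (\<lambda>c. map_pmf (\<lambda>(e, f) x. e x - f x) (pair_pmf (E1 c) (E2 c)))"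
  let ?\<Omega> = "pair_pmf (E2 2) (pair_pmf (A 0) (A 1))"
  have run: "run_protocol (closeness_protocol k l t n1 n2 m1 m2 \<nu>1 \<nu>2 \<mu>1 \<mu>2) p q
      = map_pmf (\<lambda>(e, a, a'). statistic ?I l e a a' \<le> t) ?\<Omega>"
    unfolding run_closeness_protocol A_def E1_def E2_def M by (rule decision_law[OF p q refl n])
  have E1: "estimates ?I (E1 c) (pmf p) (\<lambda>x. pmf p x / M1 + v1 / M1\<^sup>2)" if "c < 3" for c
    unfolding E1_def M by (rule histogram_estimates[OF p refl that m(1) \<nu>1(1,2,3)])
  have E2: "estimates ?I (E2 c) (pmf q) (\<lambda>x. pmf q x / M2 + v2 / M2\<^sup>2)" if "c < 3" for c
    unfolding E2_def M by (rule histogram_estimates[OF q refl that _ \<nu>2(1,2,3)]) (use m in simp)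
  have A: "estimates ?I (A c) (\<lambda>x. pmf p x - pmf q x) (\<lambda>x. (pmf p x + pmf q x) / M1 + s)" if "c < 3" for c
  proof (rule estimates_mono)
    show "estimates ?I (A c) (\<lambda>x. pmf p x - pmf q x) (\<lambda>x. (pmf p x / M1 + v1 / M1\<^sup>2) + (pmf q x / M2 + v2 / M2\<^sup>2))"
      unfolding A_def by (rule estimates_diff[OF E1[OF that] E2[OF that]])
    fix x
    \<comment> \<open>The second group is the larger one, so both sampling errors are expressed with
      the smaller size.\<close>
    have "pmf q x / M2 \<le> pmf q x / M1" using Mpos by (intro divide_left_mono) auto
    then show "(pmf p x / M1 + v1 / M1\<^sup>2) + (pmf q x / M2 + v2 / M2\<^sup>2) \<le> (pmf p x + pmf q x) / M1 + s"
      by (simp add: s add_divide_distrib)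
  qed
  have W: "estimates ?I (E2 2) (pmf q) (\<lambda>x. pmf q x / M2 + l\<^sup>2)"
  proof (rule estimates_mono[OF E2])
    have "(sqrt v2 / M2)\<^sup>2 \<le> l\<^sup>2" using l Mpos \<nu>2 by (intro power_mono) auto
    then show "pmf q x / M2 + v2 / M2\<^sup>2 \<le> pmf q x / M2 + l\<^sup>2" for x using \<nu>2 by (simp add: power_divide)
  qed simp
  have pos: "expect (E2 2) (\<lambda>e. max 0 (e x)) \<le> pmf q x + l" if "x \<in> ?I" for x
  proof -
    have "expect (E2 2) (\<lambda>e. max 0 (e x)) \<le> pmf q x + sqrt v2 / M2"
      unfolding E2_def M by (rule histogram_positive_part[OF q refl _ _ \<nu>2(1,2,3) that]) (use m in simp_all)
    then show ?thesis using l by simp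
  qed
  have s0: "0 \<le> s" unfolding s using \<nu>1 \<nu>2 by auto
  have t': "t = \<alpha>\<^sup>2 / (30 * (card ?I * l))" using t by simp
  note error = tester_error[OF A A _ _ _ s0 Mpos(1) lpos W Mpos(2) _ pos kl \<alpha> t']
  show "(p = q \<longrightarrow> 2 / 3 \<le> pmf (run_protocol (closeness_protocol k l t n1 n2 m1 m2 \<nu>1 \<nu>2 \<mu>1 \<mu>2) p q) True) \<and>
      (\<alpha> < tv_distance k p q \<longrightarrow> 2 / 3 \<le> pmf (run_protocol (closeness_protocol k l t n1 n2 m1 m2 \<nu>1 \<nu>2 \<mu>1 \<mu>2) p q) False)"
  proof (intro conjI impI)
    let ?f = "\<lambda>(e, a, a'). statistic ?I l e a a' \<le> t"
    assume "p = q"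
    then have "measure_pmf.prob ?\<Omega> {(e, a, a'). statistic ?I l e a a' > t} \<le> 1 / 3"
      by (intro error(1)) (use J1 J2 J3 sum_distribution[OF q] in auto)
    moreover have "{(e, a, a'). statistic ?I l e a a' > t} = {x. ?f x = False}" by auto
    ultimately show "2 / 3 \<le> pmf (run_protocol (closeness_protocol k l t n1 n2 m1 m2 \<nu>1 \<nu>2 \<mu>1 \<mu>2) p q) True"
      unfolding run using pmf_map_bool_ge[of ?\<Omega> ?f False] by (simp only: not_False_eq_True)
  next
    let ?f = "\<lambda>(e, a, a'). statistic ?I l e a a' \<le> t"
    assume "\<alpha> < tv_distance k p q"
    then have "measure_pmf.prob ?\<Omega> {(e, a, a'). statistic ?I l e a a' \<le> t} \<le> 1 / 3"
      by (intro error(2)) (use J1 J2 J3 sum_distribution[OF q] in \<open>auto simp: tv_distance_def\<close>)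
    moreover have "{(e, a, a'). statistic ?I l e a a' \<le> t} = {x. ?f x = True}" by auto
    ultimately show "2 / 3 \<le> pmf (run_protocol (closeness_protocol k l t n1 n2 m1 m2 \<nu>1 \<nu>2 \<mu>1 \<mu>2) p q) False"
      unfolding run using pmf_map_bool_ge[of ?\<Omega> ?f True] by (simp only: not_True_eq_False)
  qed
qed

section \<open>Choice of parameters\<close>

text \<open>Solved for \<open>m\<close>, the conditions \<open>h1\<close>, \<open>h2\<close>,
  \<open>h3\<close> read, up to constants, sqrt(k)/\<alpha>^2, k^(3/4) sqrt(v)/\<alpha> and k^(2/3)
  / (\<alpha>^(4/3) r^(1/3)). With \<open>v\<close> of order \<open>1 / \<epsilon>1^2\<close> these
  are the three terms of the bound, apart from the logarithm.\<close>

lemma tester_parameters: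
  fixes k m :: nat and \<alpha> r v m2 M1 M2 l t s :: real
  assumes k: "k \<ge> 1" and \<alpha>: "0 < \<alpha>" "\<alpha> \<le> 1" and r: "1 \<le> r" and m: "m \<ge> 1" and m2: "r * m / 2 \<le> m2"
    and v: "v = 0 \<or> 1 \<le> v"
    and h1: "10^12 * k \<le> \<alpha>^4 * m^2"
    and h2: "10^12 * k^3 * v\<^sup>2 \<le> \<alpha>^4 * m^4"
    and h3: "10^12 * k^2 \<le> \<alpha>^4 * r * m^3"
    and M: "M1 = m / 3" "M2 = m2 / 3" and l: "l = max (1 / k) (sqrt (r * v) / M2)"
    and t: "t = \<alpha>\<^sup>2 / (30 * (k * l))" and s: "s = v / M1\<^sup>2 + r * v / M2\<^sup>2"
  shows "240 * (4 * k + 2 / (M2 * l\<^sup>2)) / M1\<^sup>2 \<le> t\<^sup>2 / 2500"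
    and "3 / (l * M1\<^sup>2) \<le> t / 2500"
    and "3 * k * s\<^sup>2 / l\<^sup>2 \<le> t\<^sup>2 / 2500"
proof -
  define K where "K = real k"
  define n where "n = real m"
  have K: "K \<ge> 1" and n: "n \<ge> 1" using k m by (auto simp: K_def n_def)
  \<comment> \<open>\<open>v \<le> v\<^sup>2\<close> lets a term linear in \<open>v\<close>, coming
    from \<open>y\<^sup>2\<close>, be covered by \<open>h2\<close>.\<close>
  have v0: "v \<ge> 0" "v \<le> v\<^sup>2" using v by (auto simp: power2_eq_square mult_le_cancel_left1)
  have H1: "10^12 * K \<le> \<alpha>^4 * n^2" and H2: "10^12 * (K^3 * v\<^sup>2) \<le> \<alpha>^4 * n^4" and H3: "10^12 * K^2 \<le> \<alpha>^4 * (r * n^3)"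
    using h1 h2 h3 unfolding K_def n_def by (simp_all add: mult.assoc)
  have M2: "r * n / 6 \<le> M2" using m2 by (simp add: M n_def)
  have rn: "r * n > 0" using r n by simp
  then have M2pos: "M2 > 0" using M2 by linarith
  \<comment> \<open>\<open>y\<close> measures the loss in signal when the noise forces
    \<open>l\<close> above \<open>1 / k\<close>: the threshold is
    \<open>\<alpha>^2 / (30 * y)\<close>.\<close>
  define y where "y = K * l"
  have lpos: "l > 0" using K l unfolding K_def[symmetric] by (simp add: less_max_iff_disj)
  have "1 / K \<le> l" unfolding l K_def by simp
  then have y1: "y \<ge> 1" using K by (simp add: y_def field_simps)
  \<comment> \<open>Noise variance grows by \<open>r\<close> but the squared sample size by about
    \<open>r^2\<close>, so the second group is no noisier, up to a constant, than the first.\<close>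
  have rv: "r * v / M2\<^sup>2 \<le> 36 * v / n\<^sup>2"
  proof -
    have "(r * n / 6)\<^sup>2 \<le> M2\<^sup>2" using M2 rn by (intro power_mono) auto
    then have "r * v / M2\<^sup>2 \<le> r * v / (r * n / 6)\<^sup>2" using r v0 rn n M2pos by (intro divide_left_mono mult_pos_pos zero_less_power) auto
    also have "\<dots> = 36 * v / (r * n\<^sup>2)" using r n by (simp add: power2_eq_square field_simps)
    also have "\<dots> \<le> 36 * v / n\<^sup>2" using r n v0 by (intro divide_left_mono) (auto simp: mult_le_cancel_right1)
    finally show ?thesis .
  qed
  have y2: "y\<^sup>2 \<le> 1 + 36 * K\<^sup>2 * v / n\<^sup>2"
  proof -
    have "l\<^sup>2 \<le> (1 / K)\<^sup>2 + (sqrt (r * v) / M2)\<^sup>2"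
      unfolding l K_def[symmetric] by (cases "1 / K \<le> sqrt (r * v) / M2") (auto simp: max_def)
    also have "(sqrt (r * v) / M2)\<^sup>2 \<le> 36 * v / n\<^sup>2" using rv r v0 by (simp add: power_divide)
    finally have "K\<^sup>2 * l\<^sup>2 \<le> K\<^sup>2 * ((1 / K)\<^sup>2 + 36 * v / n\<^sup>2)" by (intro mult_left_mono) auto
    then show ?thesis using K by (simp add: y_def power_mult_distrib distrib_left power_divide mult_ac)
  qed
  have tt: "t\<^sup>2 / 2500 = \<alpha>^4 / (2250000 * y\<^sup>2)"
    by (simp add: t y_def K_def power_divide power_mult_distrib flip: power_mult)
  show "240 * (4 * k + 2 / (M2 * l\<^sup>2)) / M1\<^sup>2 \<le> t\<^sup>2 / 2500"
  proof -
    have 1: "4 * K * y\<^sup>2 * n\<^sup>2 \<le> 148 / 10^12 * (\<alpha>^4 * n^4)"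
    proof -
      have "4 * K * y\<^sup>2 * n\<^sup>2 \<le> 4 * K * (1 + 36 * K\<^sup>2 * v / n\<^sup>2) * n\<^sup>2"
        using y2 K by (intro mult_right_mono mult_left_mono) auto
      also have "\<dots> = 4 * K * n\<^sup>2 + 144 * (K^3 * v)"
        using n by (simp add: field_simps power2_eq_square power3_eq_cube)
      also have "\<dots> \<le> 4 * K * n\<^sup>2 + 144 * (K^3 * v\<^sup>2)"
        using v0 K by (intro add_left_mono mult_left_mono) auto
      also have "\<dots> \<le> 4 / 10^12 * (\<alpha>^4 * n^2) * n\<^sup>2 + 144 / 10^12 * (\<alpha>^4 * n^4)"
        using H1 H2 by (intro add_mono mult_right_mono) auto
      also have "\<dots> = 148 / 10^12 * (\<alpha>^4 * n^4)" by (simp add: power2_eq_square power4_eq_xxxx field_simps)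
      finally show ?thesis .
    qed
    have 2: "2 * K\<^sup>2 / M2 * n\<^sup>2 \<le> 12 / 10^12 * (\<alpha>^4 * n^4)"
    proof -
      have "2 * K\<^sup>2 / M2 \<le> 2 * K\<^sup>2 / (r * n / 6)"
        using M2 M2pos rn by (intro divide_left_mono) auto
      then have "2 * K\<^sup>2 / M2 * n\<^sup>2 \<le> 2 * K\<^sup>2 / (r * n / 6) * n\<^sup>2" by (intro mult_right_mono) auto
      also have "\<dots> = 12 * K\<^sup>2 * n / r" using n r by (simp add: power2_eq_square field_simps)
      also have "\<dots> \<le> (12 / 10^12 * (\<alpha>^4 * (r * n^3))) * n / r"
      proof -
        have "12 * K\<^sup>2 \<le> 12 / 10^12 * z" if "10^12 * K\<^sup>2 \<le> z" for z :: real using that by simp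
        from this[OF H3] show ?thesis using n r by (intro divide_right_mono mult_right_mono) auto
      qed
      also have "\<dots> = 12 / 10^12 * (\<alpha>^4 * n^4)" using r by (simp add: power3_eq_cube power4_eq_xxxx field_simps)
      finally show ?thesis .
    qed
    have "(4 * K * y\<^sup>2 + 2 * K\<^sup>2 / M2) * n\<^sup>2 \<le> 160 / 10^12 * (\<alpha>^4 * n^4)"
      using 1 2 by (simp add: distrib_right)
    also have "\<dots> = 160 / 10^12 * (\<alpha>^4 * n^2) * n\<^sup>2" by (simp add: power2_eq_square power4_eq_xxxx)
    finally have 3: "4 * K * y\<^sup>2 + 2 * K\<^sup>2 / M2 \<le> 160 / 10^12 * (\<alpha>^4 * n\<^sup>2)"
      using n by (simp only: mult_le_cancel_right) auto
    have "240 * (4 * k + 2 / (M2 * l\<^sup>2)) / M1\<^sup>2 = 2160 / (y\<^sup>2 * n\<^sup>2) * (4 * K * y\<^sup>2 + 2 * K\<^sup>2 / M2)"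
      using lpos K n M2pos by (simp add: M(1) y_def n_def[symmetric] K_def[symmetric] power_mult_distrib power_divide field_simps)
    also have "\<dots> \<le> 2160 / (y\<^sup>2 * n\<^sup>2) * (160 / 10^12 * (\<alpha>^4 * n\<^sup>2))"
      using 3 by (intro mult_left_mono) auto
    \<comment> \<open>The tightest use of \<open>10^12\<close>: about 3.5e-7 against 1/2250000,
      which is about 4.4e-7; here 2250000 = 2500 * 30^2.\<close>
    also have "\<dots> = 345600 / 10^12 * \<alpha>^4 / y\<^sup>2" using n by simp
    also have "\<dots> \<le> 1 / 2250000 * \<alpha>^4 / y\<^sup>2" by (intro divide_right_mono mult_right_mono) auto
    also have "\<dots> = \<alpha>^4 / (2250000 * y\<^sup>2)" by simp
    finally show ?thesis unfolding tt .
  qed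
  show "3 / (l * M1\<^sup>2) \<le> t / 2500"
  proof -
    have "\<alpha>^4 \<le> \<alpha>^2" using \<alpha> by (intro power_decreasing) auto
    then have "\<alpha>^4 * n^2 \<le> \<alpha>^2 * n^2" by (intro mult_right_mono) auto
    then have "K \<le> 1 / 10^12 * (\<alpha>\<^sup>2 * n\<^sup>2)" using H1 by simp
    have "3 / (l * M1\<^sup>2) = 27 / (y * n\<^sup>2) * K"
      using K n lpos by (simp add: M(1) y_def n_def[symmetric] power_divide field_simps)
    also have "\<dots> \<le> 27 / (y * n\<^sup>2) * (1 / 10^12 * (\<alpha>\<^sup>2 * n\<^sup>2))"
      using y1 by (intro mult_left_mono \<open>K \<le> _\<close>) auto
    also have "\<dots> = 27 / 10^12 * \<alpha>\<^sup>2 / y" using n by simp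
    also have "\<dots> \<le> 1 / 75000 * \<alpha>\<^sup>2 / y" using y1 by (intro divide_right_mono mult_right_mono) auto
    also have "\<dots> = t / 2500" by (simp add: t y_def K_def)
    finally show ?thesis .
  qed
  show "3 * k * s\<^sup>2 / l\<^sup>2 \<le> t\<^sup>2 / 2500"
  proof -
    have "v / M1\<^sup>2 = 9 * v / n\<^sup>2" by (simp add: M(1) n_def power_divide)
    then have "s \<le> 45 * v / n\<^sup>2" using rv by (simp add: s add_divide_distrib[symmetric])
    moreover have "0 \<le> s" using v0 r by (simp add: s)
    ultimately have "s\<^sup>2 \<le> (45 * v / n\<^sup>2)\<^sup>2" by (intro power_mono) auto
    also have "\<dots> = 2025 * v\<^sup>2 / n^4" by (simp add: power_divide power_mult_distrib flip: power_mult)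
    finally have s2: "s\<^sup>2 \<le> 2025 * v\<^sup>2 / n^4" .
    have "3 * k * s\<^sup>2 / l\<^sup>2 = 3 / y\<^sup>2 * (K^3 * s\<^sup>2)"
      using K lpos by (simp add: y_def K_def[symmetric] power_mult_distrib power2_eq_square power3_eq_cube)
    also have "\<dots> \<le> 3 / y\<^sup>2 * (K^3 * (2025 * v\<^sup>2 / n^4))"
      using s2 K by (intro mult_left_mono) auto
    also have "\<dots> = 6075 / (y\<^sup>2 * n^4) * (K^3 * v\<^sup>2)" by simp
    also have "\<dots> \<le> 6075 / (y\<^sup>2 * n^4) * (1 / 10^12 * (\<alpha>^4 * n^4))"
      using H2 n by (intro mult_left_mono) auto
    also have "\<dots> = 6075 / 10^12 * \<alpha>^4 / y\<^sup>2" using n by simp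
    also have "\<dots> \<le> 1 / 2250000 * \<alpha>^4 / y\<^sup>2" by (intro divide_right_mono mult_right_mono) auto
    also have "\<dots> = \<alpha>^4 / (2250000 * y\<^sup>2)" by simp
    finally show ?thesis unfolding tt .
  qed
qed

text \<open>One user is set aside for the noise, and division by 3 may leave up to two more without
  a task.\<close>

lemma second_group_size:
  fixes r :: real and m n2 :: nat
  assumes r: "r \<ge> 1" and m: "m \<ge> 2" and n2: "n2 = nat \<lceil>r * real (3 * m + 1)\<rceil>"
  defines "m2 \<equiv> (n2 - 1) div 3"
  shows "3 * m2 < n2" "m \<le> m2" "r * m / 2 \<le> m2"
proof -
  have ge: "r * real (3 * m + 1) \<le> real n2" unfolding n2 by (simp add: real_nat_ceiling_ge)
  have "real (3 * m + 1) \<le> r * real (3 * m + 1)" using r by (simp add: mult_le_cancel_right1)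
  then have "3 * m + 1 \<le> n2" using ge by linarith
  then show "3 * m2 < n2" "m \<le> m2" unfolding m2_def by auto
  have "n2 \<le> 3 * m2 + 3" unfolding m2_def by auto
  then have "r * real (3 * m + 1) \<le> 3 * real m2 + 3" using ge by linarith
  \<comment> \<open>Rounding loses at most 1, and this is at most half of
    \<open>r * m\<close>.\<close>
  moreover have "2 \<le> r * m" using r m mult_mono[of 1 r 2 "real m"] by simp
  ultimately show "r * m / 2 \<le> m2" using r by (simp add: distrib_left)
qed

lemma powr_power3: "x > 0 \<Longrightarrow> (x powr a) ^ 3 = x powr (3 * a)" for x a :: real
  by (simp add: powr_powr mult.commute flip: powr_numeral)

text \<open>
  The second and third bound correspond to \<open>ln (1/\<delta>) \<ge> 1\<close>: since \<open>\<epsilon>1 \<le> 1\<close>, the product of the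
  first term and the square of the second dominates \<open>k\<^sup>2 / \<alpha>\<^sup>4\<close>, so the minimum is not needed.
\<close>

lemma sample_size_bounds:
  fixes k n :: nat and \<alpha> \<epsilon>1 \<epsilon>2 b :: real
  assumes k: "k \<ge> 1" and \<alpha>: "0 < \<alpha>" and \<epsilon>: "0 < \<epsilon>1" "\<epsilon>1 \<le> 1" "0 < \<epsilon>2" "\<epsilon>2 \<le> \<epsilon>1"
    and n: "10^6 * (sqrt k / \<alpha>^2) \<le> n"
    and b: "b = (k powr (2/3) / \<alpha> powr (4/3)) * (\<epsilon>2/\<epsilon>1) powr (2/3)"
  defines "r \<equiv> (\<epsilon>1 / \<epsilon>2)\<^sup>2"
  shows "10^12 * k \<le> \<alpha>^4 * n^2"
    and "10^6 * (k powr (3/4) / (\<alpha> * \<epsilon>1)) \<le> n \<Longrightarrow> 10^12 * k^3 * (32 / \<epsilon>1\<^sup>2)\<^sup>2 \<le> \<alpha>^4 * n^4"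
    and "10^6 * (k powr (3/4) / (\<alpha> * \<epsilon>1)) \<le> n \<Longrightarrow> 10^12 * k^2 \<le> \<alpha>^4 * r * n^3"
    and "10^6 * b \<le> n \<Longrightarrow> 10^12 * k^2 \<le> \<alpha>^4 * r * n^3"
proof -
  \<comment> \<open>The fourth root turns \<open>sqrt k\<close>, \<open>k powr (3/4)\<close> and
    \<open>k\<close> into integer powers.\<close>
  define u where "u = real k powr (1/4)"
  define N where "N = real n"
  have k0: "real k > 0" using k by simp
  have u: "u > 0" using k0 by (simp add: u_def)
  have "u ^ 4 = real k" using k0 unfolding u_def by (simp add: powr_powr flip: powr_numeral)
  then have uk: "real k = u ^ 4" by simp
  have u2: "sqrt k = u ^ 2" unfolding uk using u by (simp add: real_sqrt_unique power4_eq_xxxx power2_eq_square)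
  have u3: "k powr (3/4) = u ^ 3" unfolding u_def using k0 by (simp add: powr_power3)
  have r: "1 \<le> r" using \<epsilon> by (simp add: r_def one_le_power)
  have N1: "10^6 * u^2 \<le> \<alpha>\<^sup>2 * N" using n \<alpha> unfolding u2 N_def by (simp add: field_simps)
  have "(10^6 * u^2)^2 \<le> (\<alpha>\<^sup>2 * N)^2" using N1 by (intro power_mono) auto
  then show "10^12 * k \<le> \<alpha>^4 * n^2"
    by (simp add: uk N_def power_mult_distrib flip: power_mult)
  have r3: "\<alpha>^4 * \<epsilon>1\<^sup>2 * N^3 \<le> \<alpha>^4 * r * N^3"
  proof -
    have "\<epsilon>1\<^sup>2 \<le> 1" using \<epsilon> by (intro power_le_one) auto
    then show ?thesis using r by (intro mult_right_mono mult_left_mono) (auto simp: N_def)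
  qed
  {
    assume "10^6 * (k powr (3/4) / (\<alpha> * \<epsilon>1)) \<le> n"
    then have N2: "10^6 * u^3 \<le> \<alpha> * \<epsilon>1 * N" using \<alpha> \<epsilon> unfolding u3 N_def by (simp add: field_simps)
    have "(10^6 * u^3)^4 \<le> (\<alpha> * \<epsilon>1 * N)^4" using N2 u by (intro power_mono) auto
    then have "10^24 * u^12 \<le> \<alpha>^4 * N^4 * \<epsilon>1^4"
      by (simp add: power_mult_distrib mult_ac flip: power_mult)
    \<comment> \<open>1024 is the square of the 32 in the noise variance.\<close>
    moreover have "10^12 * u^12 * 1024 \<le> 10^24 * u^12" using u by simp
    ultimately have "10^12 * u^12 * 1024 \<le> \<alpha>^4 * N^4 * \<epsilon>1^4" by linarith
    then have "10^12 * u^12 * 1024 / \<epsilon>1^4 \<le> \<alpha>^4 * N^4" using \<epsilon> by (simp add: divide_le_eq)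
    then show "10^12 * k^3 * (32 / \<epsilon>1\<^sup>2)\<^sup>2 \<le> \<alpha>^4 * n^4"
      by (simp add: uk N_def power_divide flip: power_mult)
    have "(10^6 * u^2) * (10^6 * u^3)^2 \<le> (\<alpha>\<^sup>2 * N) * (\<alpha> * \<epsilon>1 * N)^2"
      using power_mono[OF N2, of 2] u by (intro mult_mono[OF N1]) (auto simp: N_def)
    also have "(10^6 * u^2) * (10^6 * u^3)^2 = 10^18 * u^8"
      by (simp add: power_mult_distrib flip: power_mult power_add)
    also have "(\<alpha>\<^sup>2 * N) * (\<alpha> * \<epsilon>1 * N)^2 = \<alpha>^4 * \<epsilon>1\<^sup>2 * N^3"
      by (simp add: power2_eq_square power3_eq_cube power4_eq_xxxx)
    finally have "10^18 * u^8 \<le> \<alpha>^4 * r * N^3" using r3 by linarith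
    moreover have "10^12 * u^8 \<le> 10^18 * u^8" using u by simp
    ultimately have "10^12 * u^8 \<le> \<alpha>^4 * r * N^3" by linarith
    then show "10^12 * k^2 \<le> \<alpha>^4 * r * n^3"
      by (simp add: uk N_def flip: power_mult)
  }
  assume "10^6 * b \<le> n"
  moreover have b0: "b > 0" unfolding b using k0 \<alpha> \<epsilon> by simp
  ultimately have "(10^6 * b)^3 \<le> N^3" unfolding N_def by (intro power_mono) auto
  moreover have "b^3 = k^2 / (\<alpha>^4 * r)"
  proof -
    have "b^3 = (k powr 2 / \<alpha> powr 4) * (\<epsilon>2/\<epsilon>1) powr 2"
      unfolding b using k0 \<alpha> \<epsilon> by (simp add: power_mult_distrib power_divide powr_power3)
    also have "\<dots> = k^2 / (\<alpha>^4 * r)"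
      using k0 \<alpha> \<epsilon> by (simp add: r_def power_divide)
    finally show ?thesis .
  qed
  ultimately have "10^18 * (k^2 / (\<alpha>^4 * r)) \<le> N^3" by (simp add: power_mult_distrib)
  then have "10^18 * real k^2 \<le> N^3 * (\<alpha>^4 * r)" using \<alpha> r by (simp add: divide_le_eq)
  moreover have "10^12 * real k^2 \<le> 10^18 * real k^2" by simp
  ultimately have "10^12 * real k^2 \<le> N^3 * (\<alpha>^4 * r)" by (rule order_trans[rotated])
  then show "10^12 * k^2 \<le> \<alpha>^4 * r * n^3" unfolding N_def by (simp add: mult_ac)
qed

text \<open>Half of \<open>\<epsilon>\<close> per shift turns the variance
  \<open>8 / \<rho>^2\<close> into \<open>32 / \<epsilon>^2\<close>. If
  \<open>ln (1/\<delta>) < 1\<close>, then \<open>\<delta> > 1/e\<close>, hence at least 1/3 as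
  \<open>exp 1 \<le> 3\<close>, and zero noise will do: the sending rate 1/3 is matched to the
  threshold of the logarithm.\<close>

lemma noise_exists:
  fixes \<epsilon> \<delta> :: real
  assumes \<epsilon>: "0 < \<epsilon>" "\<epsilon> \<le> 1" and \<delta>: "0 < \<delta>"
  shows "\<exists>\<nu> \<mu>. finite (set_pmf \<nu>) \<and> expect \<nu> real = \<mu> \<and>
      expect \<nu> (\<lambda>n. (real n - \<mu>)\<^sup>2) \<le> (if ln (1/\<delta>) \<ge> 1 then 32 / \<epsilon>\<^sup>2 else 0) \<and>
      (1 / 3 \<le> \<delta> \<or> shift_private (\<epsilon> / 2) (\<delta> / 3) \<nu>)"
proof (cases "ln (1/\<delta>) \<ge> 1")
  case True
  have "8 / (\<epsilon> / 2)\<^sup>2 = 32 / \<epsilon>\<^sup>2" by (simp add: power_divide)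
  then show ?thesis using shift_private_noise_exists[of "\<epsilon> / 2" "\<delta> / 3"] True \<epsilon> \<delta> by auto
next
  case False
  have "1 / \<delta> \<le> 3"
  proof -
    have "1 / \<delta> = exp (ln (1 / \<delta>))" using \<delta> by simp
    also have "\<dots> \<le> exp 1" using False by simp
    also have "\<dots> \<le> 3" by (rule exp_le)
    finally show ?thesis .
  qed
  then have "1 / 3 \<le> \<delta>" using \<delta> by (simp add: field_simps)
  then show ?thesis using False by (intro exI[of _ "return_pmf 0"] exI[of _ 0]) auto
qed
theorem theorem3p7:
  shows "\<exists>C::real. C > 0 \<and>
    (\<forall>(k::nat) (\<alpha>::real) (\<epsilon>1::real) (\<epsilon>2::real) (\<delta>::real).
       k \<ge> 1 \<longrightarrow> 0 < \<alpha> \<longrightarrow> \<alpha> \<le> 1 \<longrightarrow>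
       0 < \<epsilon>1 \<longrightarrow> \<epsilon>1 \<le> 1 \<longrightarrow> 0 < \<epsilon>2 \<longrightarrow> \<epsilon>2 \<le> 1 \<longrightarrow> \<epsilon>1 \<ge> \<epsilon>2 \<longrightarrow>
       0 < \<delta> \<longrightarrow> \<delta> \<le> 1 \<longrightarrow>
       (\<exists>P :: nat shuffle_protocol.
          private_coin P \<and>
          real (users1 P) \<le> C * (sqrt (real k) / \<alpha>^2
             + (real k powr (3/4) * sqrt (ln (1/\<delta>))) / (\<alpha> * \<epsilon>1)
             + min_term k \<alpha> \<epsilon>1 \<epsilon>2 \<delta>) \<and>
          users2 P = nat \<lceil>(\<epsilon>1/\<epsilon>2)^2 * real (users1 P)\<rceil> \<and>
          tests_closeness k \<alpha> P \<and>
          shuffle_private1 k \<epsilon>1 \<delta> P \<and>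
          shuffle_private2 k \<epsilon>2 \<delta> P))"
\<comment> \<open>There are \<open>3 * m1 + 1\<close> users with
  \<open>m1 \<le> 10^6 * X + 1\<close>, and the additive 4 is absorbed because
  \<open>X \<ge> 1\<close>.\<close>
proof (intro exI[of _ 4000000] conjI allI impI)
  fix k :: nat and \<alpha> \<epsilon>1 \<epsilon>2 \<delta> :: real
  assume k: "k \<ge> 1" and \<alpha>: "0 < \<alpha>" "\<alpha> \<le> 1" and \<epsilon>1: "0 < \<epsilon>1" "\<epsilon>1 \<le> 1" and \<epsilon>2: "0 < \<epsilon>2" "\<epsilon>2 \<le> 1"
    and \<epsilon>12: "\<epsilon>1 \<ge> \<epsilon>2" and \<delta>: "0 < \<delta>" "\<delta> \<le> 1"
  define r where "r = (\<epsilon>1 / \<epsilon>2)\<^sup>2"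
  define T1 where "T1 = sqrt (real k) / \<alpha>\<^sup>2"
  define T2 where "T2 = (real k powr (3/4) * sqrt (ln (1/\<delta>))) / (\<alpha> * \<epsilon>1)"
  define b where "b = (real k powr (2/3) / \<alpha> powr (4/3)) * (\<epsilon>2/\<epsilon>1) powr (2/3)"
  \<comment> \<open>In both regimes \<open>X\<close> stays below the claimed bound: for a large
    logarithm the minimum is dropped as nonnegative, otherwise the minimum is \<open>b\<close> and
    \<open>T2\<close> is dropped.\<close>
  define X where "X = T1 + (if ln (1/\<delta>) \<ge> 1 then T2 else b)"
  define m1 where "m1 = nat \<lceil>10^6 * X\<rceil>"
  define n1 where "n1 = 3 * m1 + 1"
  define n2 where "n2 = nat \<lceil>r * real n1\<rceil>"
  define m2 where "m2 = (n2 - 1) div 3"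
  define v where "v = (if ln (1/\<delta>) \<ge> 1 then 32 / \<epsilon>1\<^sup>2 else 0)"
  have L0: "0 \<le> ln (1/\<delta>)" using \<delta> by simp
  have b0: "0 \<le> b" by (simp add: b_def)
  have T20: "0 \<le> T2" using \<alpha> \<epsilon>1 L0 by (simp add: T2_def)
  have T1: "1 \<le> T1"
  proof -
    have "\<alpha>\<^sup>2 \<le> 1" using \<alpha> by (intro power_le_one) auto
    also have "1 \<le> sqrt (real k)" using k by simp
    finally show ?thesis using \<alpha> by (simp add: T1_def)
  qed
  have X: "T1 \<le> X" "X \<le> T1 + T2 + min_term k \<alpha> \<epsilon>1 \<epsilon>2 \<delta>"
    using b0 T20 by (auto simp: X_def min_term_def Let_def b_def)
  have m1: "10^6 * X \<le> m1" "m1 \<le> 10^6 * X + 1"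
    unfolding m1_def using X T1 by (simp_all add: real_nat_ceiling_ge)
  then have "2 \<le> real m1" using X T1 by simp
  then have m1_ge: "m1 \<ge> 2" by simp
  have r: "1 \<le> r" using \<epsilon>2 \<epsilon>12 by (simp add: r_def one_le_power)
  have v: "v = 0 \<or> 1 \<le> v" "0 \<le> v"
  proof -
    have "\<epsilon>1\<^sup>2 \<le> 1" using \<epsilon>1 by (intro power_le_one) auto
    then have "1 \<le> 32 / \<epsilon>1\<^sup>2" using \<epsilon>1 by (simp add: le_divide_eq)
    then show "v = 0 \<or> 1 \<le> v" "0 \<le> v" by (auto simp: v_def)
  qed
  note size = second_group_size[OF r m1_ge n2_def[unfolded n1_def], folded m2_def]
  have n1_ge: "10^6 * (sqrt k / \<alpha>^2) \<le> m1" using m1 X by (simp add: T1_def)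
  note bounds = sample_size_bounds[OF k \<alpha>(1) \<epsilon>1 \<epsilon>2(1) \<epsilon>12 n1_ge b_def, folded r_def]
  have hs: "10^12 * k^3 * v\<^sup>2 \<le> \<alpha>^4 * m1^4 \<and> 10^12 * k^2 \<le> \<alpha>^4 * r * m1^3"
  proof (cases "ln (1/\<delta>) \<ge> 1")
    case True
    have "k powr (3/4) / (\<alpha> * \<epsilon>1) * 1 \<le> k powr (3/4) / (\<alpha> * \<epsilon>1) * sqrt (ln (1/\<delta>))"
      using True \<alpha> \<epsilon>1 by (intro mult_left_mono) auto
    also have "\<dots> = T2" by (simp add: T2_def)
    also have "T2 \<le> X" using True T1 by (simp add: X_def)
    finally have "10^6 * (k powr (3/4) / (\<alpha> * \<epsilon>1)) \<le> m1" using m1 by simp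
    from bounds(2,3)[OF this] show ?thesis using True by (simp add: v_def)
  next
    case False
    then have "10^6 * b \<le> m1" using m1 T1 by (simp add: X_def)
    from bounds(4)[OF this] show ?thesis using False by (simp add: v_def)
  qed
  define l where "l = max (1 / k) (sqrt (r * v) / (m2 / 3))"
  define t where "t = \<alpha>\<^sup>2 / (30 * (k * l))"
  \<comment> \<open>By the choice of \<open>r\<close>, the noise variance of the second group is
    exactly \<open>r\<close> times that of the first, as \<open>tester_parameters\<close>
    presupposes.\<close>
  have rv: "r * v = (if ln (1/\<delta>) \<ge> 1 then 32 / \<epsilon>2\<^sup>2 else 0)"
    using \<epsilon>1 by (simp add: r_def v_def power_divide)
  obtain \<nu>1 \<mu>1 where \<nu>1: "finite (set_pmf \<nu>1)" "expect \<nu>1 real = \<mu>1" "expect \<nu>1 (\<lambda>n. (real n - \<mu>1)\<^sup>2) \<le> v"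
      "1 / 3 \<le> \<delta> \<or> shift_private (\<epsilon>1 / 2) (\<delta> / 3) \<nu>1"
    using noise_exists[OF \<epsilon>1 \<delta>(1)] unfolding v_def by blast
  obtain \<nu>2 \<mu>2 where \<nu>2: "finite (set_pmf \<nu>2)" "expect \<nu>2 real = \<mu>2" "expect \<nu>2 (\<lambda>n. (real n - \<mu>2)\<^sup>2) \<le> r * v"
      "1 / 3 \<le> \<delta> \<or> shift_private (\<epsilon>2 / 2) (\<delta> / 3) \<nu>2"
    using noise_exists[OF \<epsilon>2 \<delta>(1)] unfolding rv by blast
  define P where "P = closeness_protocol k l t n1 n2 m1 m2 \<nu>1 \<nu>2 \<mu>1 \<mu>2"
  have m1_le: "1 \<le> m1" "0 < m1" using m1_ge by auto
  note params = tester_parameters[OF k \<alpha> r m1_le(1) size(3) v(1) bounds(1) conjunct1[OF hs] conjunct2[OF hs] refl refl l_def t_def refl]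
  have tests: "tests_closeness k \<alpha> P"
    unfolding P_def
    by (rule closeness_protocol_tests[OF k \<alpha>(1) m1_le(2) size(2) _ size(1) \<nu>1(1-3) v(2) \<nu>2(1-3) _ refl refl _ _ t_def refl params])
      (use r v in \<open>auto simp: n1_def l_def\<close>)
  have p1: "differentially_private k n1 \<epsilon>1 \<delta> (shuffler_output n1 (user_randomizer m1 (3 * (k + 1)) \<nu>1) U)" for U
    by (rule shuffler_output_private[OF \<nu>1(1) refl _ \<epsilon>1 \<delta>(1) \<nu>1(4)]) (simp add: n1_def)
  have p2: "differentially_private k n2 \<epsilon>2 \<delta> (shuffler_output n2 (user_randomizer m2 (3 * (k + 1)) \<nu>2) U)" for U
    by (rule shuffler_output_private[OF \<nu>2(1) refl size(1) \<epsilon>2 \<delta>(1) \<nu>2(4)])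
  have "real n1 \<le> 3 * (10^6 * X + 1) + 1" using m1 by (simp add: n1_def)
  also have "\<dots> \<le> 4000000 * X" using X T1 by simp
  also have "\<dots> \<le> 4000000 * (T1 + T2 + min_term k \<alpha> \<epsilon>1 \<epsilon>2 \<delta>)" using X by simp
  finally have n1_le: "real n1 \<le> 4000000 * (T1 + T2 + min_term k \<alpha> \<epsilon>1 \<epsilon>2 \<delta>)" .
  show "\<exists>P :: nat shuffle_protocol.
          private_coin P \<and>
          real (users1 P) \<le> 4000000 * (sqrt (real k) / \<alpha>^2
             + (real k powr (3/4) * sqrt (ln (1/\<delta>))) / (\<alpha> * \<epsilon>1)
             + min_term k \<alpha> \<epsilon>1 \<epsilon>2 \<delta>) \<and>
          users2 P = nat \<lceil>(\<epsilon>1/\<epsilon>2)^2 * real (users1 P)\<rceil> \<and>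
          tests_closeness k \<alpha> P \<and>
          shuffle_private1 k \<epsilon>1 \<delta> P \<and>
          shuffle_private2 k \<epsilon>2 \<delta> P"
  proof (intro exI[of _ P] conjI)
    show "private_coin P" by (simp add: P_def closeness_protocol_def private_coin_def)
    show "users2 P = nat \<lceil>(\<epsilon>1/\<epsilon>2)^2 * real (users1 P)\<rceil>"
      by (simp add: P_def closeness_protocol_def n2_def r_def)
    show "tests_closeness k \<alpha> P" by (rule tests)
    show "shuffle_private1 k \<epsilon>1 \<delta> P" using p1
      by (simp add: shuffle_private1_def P_def closeness_protocol_def)
    show "shuffle_private2 k \<epsilon>2 \<delta> P" using p2
      by (simp add: shuffle_private2_def P_def closeness_protocol_def)
    show "real (users1 P) \<le> 4000000 * (sqrt (real k) / \<alpha>^2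
             + (real k powr (3/4) * sqrt (ln (1/\<delta>))) / (\<alpha> * \<epsilon>1)
             + min_term k \<alpha> \<epsilon>1 \<epsilon>2 \<delta>)"
      using n1_le by (simp add: P_def closeness_protocol_def T1_def T2_def)
  qed
qed simp

end
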